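(* Let $p$ be a prime with $p\equiv 1\pmod 4$ and let $q=p^r\equiv 1\pmod 8$. Then for every $\ell\in\mathbb{N}$ the number $\mathcal{K}_3(\Gamma(4,q^{\ell}))$ is determined by $\mathcal{K}_3(\Gamma(4,q))$, and $$\mathcal{K}_3(\Gamma(4,q^{\ell}))=\frac{q^{\ell}(q^{\ell}-1)(q^{\ell}-6e_{\ell}-11)}{2^7\cdot 3},$$ where $e_{\ell}=\tfrac12(e_1+2f_1 i)^{\ell}+\tfrac12(e_1-2f_1 i)^{\ell}=\mathrm{Re}\,(e_1+2f_1 i)^{\ell}$, with $e_1,f_1\in\mathbb{Z}$ a solution of $q=X^2+4Y^2$ satisfying $e_1\equiv 1\pmod 4$ and $(e_1,p)=1$.
   Context: The generalized Paley graph $\Gamma(k,q)$ is the Cayley graph $\mathrm{Cay}(\mathbb{F}_q,\{x^k: x\in\mathbb{F}_q^*\})$: vertex set $\mathbb{F}_q$, with $v,w$ adjacent iff $w-v$ is a nonzero $k$-th power. For a graph $H$, $\mathcal{K}_{3}(H)$ denotes the number of triangles of $H$. *)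

theory Defs
  imports
    Complex_Main
    "HOL-Library.Cardinality"
    "HOL-Number_Theory.Cong"
    "HOL-Computational_Algebra.Primes"
    "Graph_Theory.Pair_Digraph"
begin

text \<open>
  Graphs are pair digraphs of Graph_Theory, an undirected edge being a pair of opposite arcs.
  When \<open>-1\<close> is a \<open>k\<close>-th power the generalized Paley graph is symmetric; it never has loops.
  The finite field with \<open>q\<close> elements is rendered by
  an arbitrary type \<open>'a\<close> of classes \<open>field\<close> and \<open>finite\<close> with \<open>CARD('a) = q\<close>.
\<close>

definition cayley_graph :: "'a::group_add set \<Rightarrow> 'a pair_pre_digraph" where
  "cayley_graph S = \<lparr>pverts = UNIV, parcs = {(v, w). w - v \<in> S}\<rparr>"

definition gen_paley :: "nat \<Rightarrow> 'a::field pair_pre_digraph" where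
  "gen_paley k = cayley_graph {x ^ k | x. x \<noteq> 0}"

definition num_triangles :: "'a pair_pre_digraph \<Rightarrow> nat" where
  "num_triangles H =
     card {T. T \<subseteq> pverts H \<and> card T = 3 \<and> (\<forall>u\<in>T. \<forall>v\<in>T. u \<noteq> v \<longrightarrow> (u, v) \<in> parcs H)}"

text \<open>
  The explicit dependence of \<open>\<K>\<^sub>3(\<Gamma>(4, q ^ l))\<close> on \<open>N = \<K>\<^sub>3(\<Gamma>(4, q))\<close>, for given \<open>q\<close> and \<open>l\<close>:
  the number \<open>e\<close> is obtained by solving \<open>N = q (q - 1) (q - 6 e - 11) / (2 ^ 7 * 3)\<close>, and the
  imaginary part \<open>2 f\<close> is, up to its sign, the root of \<open>q - e ^ 2\<close>; the sign does not affect the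
  real part of the power.  No solution of \<open>q = X ^ 2 + 4 Y ^ 2\<close> enters.
\<close>

definition triangles_from_base :: "nat \<Rightarrow> nat \<Rightarrow> nat \<Rightarrow> real" where
  "triangles_from_base q l N =
     (let e = (real q - 11 - 2 ^ 7 * 3 * real N / (real q * (real q - 1))) / 6;
          el = Re (Complex e (sqrt (real q - e\<^sup>2)) ^ l)
      in real q ^ l * (real q ^ l - 1) * (real q ^ l - 6 * el - 11) / (2 ^ 7 * 3))"

end

theory Submission
  imports Defs "HOL-Computational_Algebra.Polynomial"
begin

text \<open>
  The count needs no complex characters.  With \<open>\<phi>\<close> the quadratic character and
  \<open>J(D) = \<Sum>\<^sub>x \<phi>(x (x\<^sup>2 + D))\<close> the Jacobsthal sum, replacing fourth powers by squares of squares
  turns the Fermat quartic \<open>x\<^sup>4 + y\<^sup>4 = 1\<close> into \<open>\<phi>\<close>-weighted sums over the conic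
  \<open>v\<^sup>2 + w\<^sup>2 = 1\<close>, whence it has \<open>q - 3 + 3 J(1)\<close> points.  This gives the number of nonzero fourth
  powers \<open>c\<close> with \<open>c - 1\<close> again one, and so the number of triangles, with \<open>e = - J(1) / 2\<close>.

  Summing \<open>J(D)\<^sup>2\<close> over all \<open>D\<close> gives \<open>J(1)\<^sup>2 + J(g)\<^sup>2 = 4 q\<close> for a nonsquare \<open>g\<close>; grouping points
  by fourth powers gives \<open>e \<equiv> 1\<close> modulo \<open>4\<close>; and Euler's criterion gives
  \<open>J(1) \<equiv> - binomial((q - 1) / 2, (q - 1) / 4)\<close> modulo \<open>p\<close>, which is nonzero.  Such an \<open>e\<close> is
  unique, so the formula holds with every admissible solution of \<open>q = X\<^sup>2 + 4 Y\<^sup>2\<close>.  For \<open>q\<^sup>l\<close> the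
  real and half the imaginary part of \<open>(e + 2 f i)\<^sup>l\<close> form an admissible solution, so no
  Hasse--Davenport relation is needed.
\<close>

subsection \<open>The quadratic character of a finite field\<close>

definition qchar :: "'a::field \<Rightarrow> int" where
  "qchar x = (if x = 0 then 0 else if \<exists>y. x = y\<^sup>2 then 1 else - 1)"

lemma qchar_0 [simp]: "qchar 0 = 0"
  by (simp add: qchar_def)

text \<open>Multiplication by \<open>x\<close> permutes the nonzero elements; comparing their
  product before and after gives the claim.\<close>

lemma power_card_minus_1:
  fixes x :: "'a::{field,finite}"
  assumes "x \<noteq> 0"
  shows "x ^ (CARD('a) - 1) = 1"
proof -
  have "\<Prod>(UNIV - {0}) = (\<Prod>y\<in>UNIV - {0}. x * y)"
    by (rule prod.reindex_bij_witness[of _ "\<lambda>y. x * y" "\<lambda>y. y / x"]) (use assms in auto)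
  also have "\<dots> = x ^ (CARD('a) - 1) * \<Prod>(UNIV - {0})"
    by (simp add: prod.distrib card_Diff_singleton)
  finally show ?thesis by simp
qed

lemma card_power_eq_le:
  fixes c :: "'a::field"
  assumes "n > 0"
  shows "card {x. x ^ n = c} \<le> n" "finite {x. x ^ n = c}"
proof -
  let ?P = "monom 1 n - [:c:]"
  have nz: "?P \<noteq> 0"
  proof
    assume "?P = 0"
    then have "coeff ?P n = 0" by simp
    then show False using assms by (simp add: coeff_pCons split: nat.splits)
  qed
  have deg: "degree ?P \<le> n"
    by (intro degree_diff_le) (auto simp: degree_monom_le)
  have eq: "{x. poly ?P x = 0} = {x. x ^ n = c}"
    by (auto simp: poly_monom)
  show "card {x. x ^ n = c} \<le> n"
    using card_poly_roots_bound[OF nz] deg eq by simp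
  show "finite {x. x ^ n = c}"
    using poly_roots_finite[OF nz] eq by simp
qed

text \<open>Translation by 1 permutes the field, so the sum of all elements absorbs
  \<open>CARD('a)\<close> copies of 1.\<close>

lemma of_nat_CARD_eq_0: "of_nat CARD('a::{field,finite}) = (0::'a)"
proof -
  have "(\<Sum>x\<in>UNIV. x + (1::'a)) = (\<Sum>x\<in>UNIV. x)"
    by (rule sum.reindex_bij_witness[of _ "\<lambda>x. x - 1" "\<lambda>x. x + 1"]) auto
  then show ?thesis by (simp add: sum.distrib)
qed

lemma one_neq_minus_one:
  assumes "odd CARD('a::{field,finite})"
  shows "(1::'a) \<noteq> - 1"
proof
  assume "(1::'a) = - 1"
  then have two: "(2::'a) = 0"
    by (metis add.right_inverse one_add_one)
  obtain k where "CARD('a) = 2 * k + 1" using assms by (blast elim: oddE)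
  then have "of_nat CARD('a) = (2 * of_nat k + 1 :: 'a)" by simp
  then show False unfolding of_nat_CARD_eq_0 two by simp
qed

lemma eq_minus_iff_zero:
  fixes x :: "'a::{field,finite}"
  assumes "odd CARD('a)"
  shows "x = - x \<longleftrightarrow> x = 0"
proof
  assume "x = - x"
  then have "x * 1 = x * (- 1)" by simp
  then show "x = 0"
    using one_neq_minus_one[OF assms] mult_left_cancel by blast
qed simp

lemma card_square_roots:
  fixes c :: "'a::{field,finite}"
  assumes "odd CARD('a)"
  shows "int (card {x. x\<^sup>2 = c}) = 1 + qchar c"
proof (cases "\<exists>y. c = y\<^sup>2")
  case True
  then obtain y where y: "c = y\<^sup>2" by blast
  then have "{x. x\<^sup>2 = c} = {y, - y}"
    by (auto simp: power2_eq_iff)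
  then show ?thesis
    using y eq_minus_iff_zero[OF assms, of y] by (auto simp: qchar_def)
next
  case False
  then have "c \<noteq> 0" by (metis zero_power2)
  moreover have "{x. x\<^sup>2 = c} = {}" using False by auto
  ultimately show ?thesis using False by (simp add: qchar_def)
qed

text \<open>Each \<open>v\<close> has \<open>1 + qchar v\<close> square roots. This is the device
  that trades squared variables for character weights.\<close>

lemma sum_squares:
  fixes f :: "'a::{field,finite} \<Rightarrow> int"
  assumes "odd CARD('a)"
  shows "(\<Sum>x\<in>UNIV. f (x\<^sup>2)) = (\<Sum>v\<in>UNIV. (1 + qchar v) * f v)"
proof -
  have "(\<Sum>x\<in>UNIV. f (x\<^sup>2)) = (\<Sum>v\<in>UNIV. \<Sum>x\<in>{x\<in>UNIV. x\<^sup>2 = v}. f (x\<^sup>2))"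
    by (rule sum.group[symmetric]) auto
  also have "\<dots> = (\<Sum>v\<in>UNIV. int (card {x. x\<^sup>2 = v}) * f v)"
    by (intro sum.cong) auto
  finally show ?thesis by (simp add: card_square_roots[OF assms])
qed

lemma sum_qchar [simp]:
  assumes "odd CARD('a::{field,finite})"
  shows "(\<Sum>x\<in>UNIV. qchar (x::'a)) = 0"
  using sum_squares[OF assms, of "\<lambda>_. 1"] by (simp add: sum.distrib)

text \<open>Euler's criterion. The nonzero squares are roots of \<open>X ^ h - 1\<close> with
  \<open>h = (CARD('a) - 1) div 2\<close>; there are \<open>h\<close> of them, so they are all the
  roots, and any other nonzero element has \<open>h\<close>-th power \<open>- 1\<close>.\<close>

lemma of_int_qchar:
  fixes x :: "'a::{field,finite}"
  assumes "odd CARD('a)"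
  shows "(of_int (qchar x) :: 'a) = x ^ ((CARD('a) - 1) div 2)"
proof -
  let ?h = "(CARD('a) - 1) div 2"
  have "card {0, 1::'a} \<le> CARD('a)" by (rule card_mono) auto
  then have h: "?h > 0" "2 * ?h = CARD('a) - 1" 
    using assms by (auto elim!: oddE)
  let ?Q = "{x::'a. x \<noteq> 0 \<and> (\<exists>y. x = y\<^sup>2)}"
  have Q: "y ^ ?h = 1" if "y \<in> ?Q" for y
  proof -
    from that obtain z where z: "y = z\<^sup>2" "z \<noteq> 0" by auto
    show ?thesis unfolding z power_mult[symmetric] h by (rule power_card_minus_1) fact
  qed
  \<comment> \<open>The number of squares comes from the vanishing character sum, without a
    generator of the multiplicative group.\<close>
  have cQ: "card ?Q = ?h"
  proof -
    have "0 = (\<Sum>x\<in>UNIV. qchar (x::'a))" using assms by simp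
    also have "\<dots> = (\<Sum>x\<in>UNIV-{0}. qchar (x::'a))" by (subst sum.remove[of _ 0]) simp_all
    also have "\<dots> = (\<Sum>x\<in>UNIV-{0}. 2 * (if x \<in> ?Q then 1 else 0) - 1)"
      by (intro sum.cong) (auto simp: qchar_def)
    also have "\<dots> = 2 * int (card ?Q) - int (CARD('a) - 1)"
      by (simp add: sum_subtractf sum_distrib_left[symmetric] sum.If_cases card_Diff_singleton
          of_nat_diff Int_def conj_commute)
    finally show ?thesis using h by linarith
  qed
  have QE: "?Q = {y. y ^ ?h = 1}"
  proof (rule card_seteq)
    show "?Q \<subseteq> {y. y ^ ?h = 1}" using Q by blast
    show "card {y::'a. y ^ ?h = 1} \<le> card ?Q" unfolding cQ by (rule card_power_eq_le) (rule h)
  qed simp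
  consider "x = 0" | "x \<in> ?Q" | "x \<noteq> 0" "x \<notin> ?Q" by blast
  then show ?thesis
  proof cases
    case 3
    have "(x ^ ?h)\<^sup>2 = 1"
      unfolding power_mult[symmetric] mult.commute[of ?h] h by (rule power_card_minus_1) fact
    then have "x ^ ?h = - 1" using 3 QE by (auto simp: power2_eq_1_iff)
    then show ?thesis using 3 by (auto simp: qchar_def)
  qed (use h Q in \<open>auto simp: qchar_def\<close>)
qed

lemma qchar_cases: "qchar x = 0 \<or> qchar x = 1 \<or> qchar x = - 1"
  by (simp add: qchar_def)

text \<open>Euler's criterion gives the identity inside the field. It lifts to the integers because
  1 and \<open>- 1\<close> are distinct there and the zero cases are matched separately.\<close>

lemma qchar_mult:
  fixes x y :: "'a::{field,finite}"
  assumes "odd CARD('a)"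
  shows "qchar (x * y) = qchar x * qchar y"
proof -
  have "(of_int (qchar (x * y)) :: 'a) = of_int (qchar x * qchar y)"
    by (simp add: of_int_qchar[OF assms] power_mult_distrib)
  moreover have "qchar (x * y) = 0 \<longleftrightarrow> qchar x * qchar y = 0"
    by (auto simp: qchar_def)
  ultimately show ?thesis
    using qchar_cases[of x] qchar_cases[of y] qchar_cases[of "x * y"]
      one_neq_minus_one[OF assms] one_neq_minus_one[OF assms, symmetric]
    by (elim disjE) simp_all
qed

lemma qchar_square: "y \<noteq> 0 \<Longrightarrow> qchar (y\<^sup>2) = 1"
  by (auto simp: qchar_def)

lemma qchar_square_if: "(qchar y)\<^sup>2 = (if y = 0 then 0 else 1)"
  by (auto simp: qchar_def)

lemma exists_nonsquare:
  assumes "odd CARD('a::{field,finite})"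
  obtains g :: "'a::{field,finite}" where "qchar g = - 1"
proof -
  have "\<exists>g::'a. qchar g = - 1"
  proof (rule ccontr)
    assume "\<nexists>g::'a. qchar g = - 1"
    then have "qchar g \<ge> 0" for g :: 'a using qchar_cases[of g] by auto
    then have "qchar (1::'a) = 0"
      using sum_qchar[OF assms] by (subst (asm) sum_nonneg_eq_0_iff) auto
    then show False by (metis qchar_square one_power2 zero_neq_one)
  qed
  then show ?thesis using that by blast
qed

text \<open>An orthogonality relation: it evaluates the inner sums in the second moment of the
  Jacobsthal sums and counts points on conics.\<close>

lemma sum_qchar_quadratic:
  fixes a b :: "'a::{field,finite}"
  assumes "odd CARD('a)"
  shows "(\<Sum>x\<in>UNIV. qchar ((x + a) * (x + b))) = (if a = b then int CARD('a) - 1 else - 1)"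
proof (cases "a = b")
  case True
  have "(\<Sum>x\<in>UNIV. qchar ((x + a) * (x + b))) = (\<Sum>x\<in>UNIV. if x + a = 0 then 0 else 1)"
    using True by (intro sum.cong) (auto simp: qchar_square power2_eq_square[symmetric])
  also have "\<dots> = (\<Sum>x\<in>UNIV - {- a}. 1)"
    by (intro sum.mono_neutral_cong_right) (auto simp: add_eq_0_iff2)
  also have "\<dots> = int CARD('a) - 1"
    by (simp add: card_Diff_singleton of_nat_diff)
  finally show ?thesis using True by simp
next
  case False
  define c where "c = b - a"
  have c: "c \<noteq> 0" using False by (simp add: c_def)
  have "(\<Sum>x\<in>UNIV. qchar ((x + a) * (x + b))) = (\<Sum>x\<in>UNIV. qchar (x * (x + c)))"
    by (rule sum.reindex_bij_witness[of _ "\<lambda>x. x - a" "\<lambda>x. x + a"]) (auto simp: c_def algebra_simps)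
  also have "\<dots> = (\<Sum>x\<in>UNIV - {0}. qchar (x * (x + c)))"
    by (subst sum.remove[of _ 0]) simp_all
  \<comment> \<open>Since \<open>x * (x + c)\<close> is the square of \<open>x\<close> times
    \<open>1 + c / x\<close>, only \<open>z = 1 + c / x\<close> matters, and it takes every value
    except 1.\<close>
  also have "\<dots> = (\<Sum>z\<in>UNIV - {1::'a}. qchar z)"
  proof (rule sum.reindex_bij_witness[of _ "\<lambda>z. c / (z - 1)" "\<lambda>x. 1 + c / x"])
    fix x :: 'a assume "x \<in> UNIV - {0}"
    then have x: "x \<noteq> 0" by simp
    then have "x * (x + c) = x\<^sup>2 * (1 + c / x)" by (simp add: field_simps power2_eq_square)
    then show "qchar (1 + c / x) = qchar (x * (x + c))"
      using x by (simp only: qchar_mult[OF assms] qchar_square[OF x])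
  qed (use c in \<open>auto simp: field_simps\<close>)
  also have "\<dots> = - 1"
    using sum_qchar[OF assms] sum.remove[of UNIV "1::'a" qchar] by (simp add: qchar_square[of 1, simplified])
  finally show ?thesis using False by simp
qed

subsection \<open>A central binomial coefficient prime to \<open>p\<close>\<close>

text \<open>Legendre's formula in recursive form: only the factors \<open>p\<close>,
  \<open>2 * p\<close>, ..., \<open>n * p\<close> contribute, and removing one \<open>p\<close> from
  each leaves \<open>fact n\<close>.\<close>

lemma multiplicity_fact_mult_add:
  fixes p n c :: nat
  assumes "prime p" "c < p"
  shows "multiplicity p (fact (p * n + c) :: nat) = n + multiplicity p (fact n :: nat)"
proof -
  have pe: "prime_elem p" using assms(1) by auto
  have small: "multiplicity p (fact (p * n + c) :: nat) = multiplicity p (fact (p * n) :: nat)"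
    if "c < p" for c n
    using that
  proof (induction c)
    case (Suc c)
    have "\<not> p dvd p * n + Suc c"
      using Suc.prems by (metis dvd_add_right_iff dvd_triv_left nat_dvd_not_less zero_less_Suc)
    then have "multiplicity p (p * n + Suc c) = 0"
      by (rule not_dvd_imp_multiplicity_0)
    moreover have "fact (p * n + Suc c) = (p * n + Suc c) * fact (p * n + c)" by simp
    ultimately show ?case
      using Suc prime_elem_multiplicity_mult_distrib[OF pe, of "p * n + Suc c" "fact (p * n + c)"]
      by simp
  qed simp
  have "multiplicity p (fact (p * n) :: nat) = n + multiplicity p (fact n :: nat)"
  proof (induction n)
    case (Suc n)
    have p0: "p > 0" using assms by simp
    have e: "p * Suc n = Suc (p * n + (p - 1))" using p0 by simp
    have "(fact (p * Suc n) :: nat) = (p * Suc n) * fact (p * n + (p - 1))"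
      unfolding e by simp
    also have "multiplicity p \<dots> = multiplicity p (p * Suc n) + multiplicity p (fact (p * n + (p - 1)) :: nat)"
      using p0 by (intro prime_elem_multiplicity_mult_distrib[OF pe]) auto
    also have "multiplicity p (p * Suc n) = 1 + multiplicity p (Suc n)"
      using p0 assms(1) by (subst prime_elem_multiplicity_mult_distrib[OF pe]) (auto simp: prime_gt_1_nat)
    also have "multiplicity p (fact (p * n + (p - 1)) :: nat) = n + multiplicity p (fact n :: nat)"
      using small[of "p - 1" n] p0 Suc by simp
    also have "1 + multiplicity p (Suc n) + (n + multiplicity p (fact n :: nat)) =
        Suc n + multiplicity p (fact (Suc n) :: nat)"
      using prime_elem_multiplicity_mult_distrib[OF pe, of "Suc n" "fact n"] by simp
    finally show ?case .
  qed simp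
  then show ?thesis using small[OF assms(2)] by simp
qed

text \<open>In base \<open>p\<close> all digits of \<open>(p ^ r - 1) div 4\<close> equal \<open>(p - 1) div 4\<close>, so doubling produces no
  carries.\<close>

lemma not_dvd_quarter_binomial:
  fixes p r :: nat
  assumes "prime p" "[p = 1] (mod 4)"
  shows "\<not> p dvd ((p ^ r - 1) div 2) choose ((p ^ r - 1) div 4)"
proof -
  have "p mod 4 = 1" using assms(2) by (simp add: cong_def)
  then obtain k where k: "p = 4 * k + 1"
    by (metis mult_div_mod_eq)
  define m where "m r = (p ^ r - 1) div 4" for r
  have pr: "p ^ r = 4 * m r + 1" for r
  proof -
    have "[p ^ r = 1 ^ r] (mod 4)" by (rule cong_pow) fact
    then have "p ^ r mod 4 = 1" by (simp add: cong_def)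
    then show ?thesis unfolding m_def by presburger
  qed
  have mS: "m (Suc r) = p * m r + k" for r
  proof -
    have "4 * m (Suc r) + 1 = (4 * k + 1) * (4 * m r + 1)"
      using pr[of "Suc r"] pr[of r] k by simp
    then show ?thesis unfolding k by (simp add: algebra_simps)
  qed
  \<comment> \<open>Both \<open>k\<close> and \<open>2 * k\<close> are below \<open>p\<close>, so
    the recursion applies to \<open>m r\<close> and to its double alike, and the ratio 2 of the
    valuations persists.\<close>
  have v: "multiplicity p (fact (2 * m r) :: nat) = 2 * multiplicity p (fact (m r) :: nat)" for r
  proof (induction r)
    case 0
    then show ?case by (simp add: m_def)
  next
    case (Suc r)
    have "2 * m (Suc r) = p * (2 * m r) + 2 * k" by (simp add: mS)
    then show ?case
      using multiplicity_fact_mult_add[OF assms(1), of "2 * k" "2 * m r"]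
        multiplicity_fact_mult_add[OF assms(1), of k "m r"] Suc k prime_gt_1_nat[OF assms(1)]
      by (simp add: mS)
  qed
  have pe: "prime_elem p" using assms(1) by auto
  have "fact (m r) * fact (m r) * ((2 * m r) choose m r) = (fact (2 * m r) :: nat)"
    using binomial_fact_lemma[of "m r" "2 * m r"] by (simp add: mult_2)
  then have "multiplicity p (fact (2 * m r) :: nat) =
      2 * multiplicity p (fact (m r) :: nat) + multiplicity p ((2 * m r) choose m r)"
    using prime_elem_multiplicity_mult_distrib[OF pe, of "fact (m r) * fact (m r)" "(2 * m r) choose m r"]
      prime_elem_multiplicity_mult_distrib[OF pe, of "fact (m r)" "fact (m r)"]
    by simp
  then have "multiplicity p ((2 * m r) choose m r) = 0" using v[of r] by simp
  then have "\<not> p dvd ((2 * m r) choose m r)"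
    using prime_gt_1_nat[OF assms(1)] by (simp add: multiplicity_eq_zero_iff)
  moreover have "(p ^ r - 1) div 2 = 2 * m r" using pr[of r] by simp
  ultimately show ?thesis by (simp add: m_def)
qed

subsection \<open>Jacobsthal sums\<close>

text \<open>If some nonzero \<open>g\<close> has \<open>g ^ n\<close> different from 1, scaling by
  \<open>g\<close> forces the sum to vanish. Otherwise all nonzero terms are 1; for
  \<open>n = 0\<close> the term at 0 is 1 as well, which makes the total \<open>CARD('a)\<close>,
  that is 0.\<close>

lemma sum_power_finite_field:
  "(\<Sum>x\<in>UNIV. (x::'a::{field,finite}) ^ n) = (if n > 0 \<and> (CARD('a) - 1) dvd n then - 1 else 0)"
proof -
  consider "n = 0" | "n > 0" "(CARD('a) - 1) dvd n" | "\<not> (CARD('a) - 1) dvd n" by auto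
  then show ?thesis
  proof cases
    case 1
    then show ?thesis by (simp add: of_nat_CARD_eq_0)
  next
    case 2
    have "x ^ n = 1" if "x \<noteq> 0" for x :: 'a
      using 2(2) power_card_minus_1[OF that] by (auto simp: power_mult)
    then have "(\<Sum>x\<in>UNIV - {0}. (x::'a) ^ n) = (\<Sum>x\<in>UNIV - {0::'a}. 1)"
      by (intro sum.cong) auto
    also have "\<dots> = - 1"
      using zero_less_card_finite[where 'a = 'a] by (simp add: card_Diff_singleton of_nat_diff of_nat_CARD_eq_0)
    finally show ?thesis using 2 by (subst sum.remove[of _ 0]) simp_all
  next
    case 3
    let ?d = "n mod (CARD('a) - 1)"
    have c1: "CARD('a) - 1 > 0"
    proof -
      have "card {0, 1::'a} \<le> CARD('a)" by (rule card_mono) auto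
      then show ?thesis by simp
    qed
    have d: "0 < ?d" "?d < CARD('a) - 1" using 3 c1 by (auto simp: dvd_eq_mod_eq_0)
    \<comment> \<open>Fewer than \<open>CARD('a) - 1\<close> elements can satisfy
      \<open>x ^ ?d = 1\<close>, so a suitable \<open>g\<close> exists by counting roots.\<close>
    have "\<exists>g::'a. g \<noteq> 0 \<and> g ^ ?d \<noteq> 1"
    proof (rule ccontr)
      assume "\<nexists>g::'a. g \<noteq> 0 \<and> g ^ ?d \<noteq> 1"
      then have "UNIV - {0::'a} \<subseteq> {x. x ^ ?d = 1}" by blast
      then have "card (UNIV - {0::'a}) \<le> card {x::'a. x ^ ?d = 1}"
        by (intro card_mono) auto
      also have "\<dots> \<le> ?d" by (rule card_power_eq_le) (rule d)
      finally show False using d by (simp add: card_Diff_singleton)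
    qed
    then obtain g :: 'a where g: "g \<noteq> 0" "g ^ ?d \<noteq> 1" by blast
    have "g ^ n = g ^ ((CARD('a) - 1) * (n div (CARD('a) - 1)) + ?d)"
      by simp
    also have "\<dots> = g ^ ?d"
      unfolding power_add power_mult power_card_minus_1[OF g(1)] by simp
    finally have gn: "g ^ n \<noteq> 1" using g by simp
    have "(\<Sum>x\<in>UNIV. (x::'a) ^ n) = (\<Sum>x\<in>UNIV. (g * x) ^ n)"
      by (rule sum.reindex_bij_witness[of _ "\<lambda>y. g * y" "\<lambda>y. y / g"]) (use g in auto)
    also have "\<dots> = g ^ n * (\<Sum>x\<in>UNIV. (x::'a) ^ n)"
      by (simp add: power_mult_distrib sum_distrib_left)
    finally show ?thesis using gn 3 by (simp add: mult_cancel_right1)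
  qed
qed

text \<open>Euler's criterion turns each term into a power of \<open>u ^ 4 + 1\<close>. After
  binomial expansion, only exponents \<open>4 * j\<close> that are positive multiples of
  \<open>CARD('a) - 1\<close> survive: the middle \<open>j\<close> gives the binomial coefficient,
  the top one the final \<open>- 1\<close>.\<close>

lemma of_int_sum_qchar_fourth:
  assumes "CARD('a::{field,finite}) mod 8 = 1"
  shows "(of_int (\<Sum>u\<in>UNIV. qchar (u ^ 4 + 1 :: 'a)) :: 'a) =
    - of_nat (((CARD('a) - 1) div 2) choose ((CARD('a) - 1) div 4)) - 1"
proof -
  define m where "m = CARD('a) div 8"
  have q: "CARD('a) = 8 * m + 1" using assms unfolding m_def by presburger
  have "card {0, 1::'a} \<le> CARD('a)" by (rule card_mono) auto
  then have m: "m > 0" using q by simp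
  have o: "odd CARD('a)" using q by simp
  have h: "(CARD('a) - 1) div 2 = 4 * m" "(CARD('a) - 1) div 4 = 2 * m" using q by auto
  have dv: "(j > 0 \<and> CARD('a) - 1 dvd 4 * j) \<longleftrightarrow> j = 2 * m \<or> j = 4 * m" if "j \<le> 4 * m" for j
  proof
    assume *: "j > 0 \<and> CARD('a) - 1 dvd 4 * j"
    then obtain c where c: "4 * j = 8 * m * c" using q by (auto simp: dvd_def)
    then have j: "j = 2 * m * c" by simp
    then have "2 * m * c \<le> 2 * m * 2" using that by simp
    then have "c \<le> 2" using m by simp
    moreover have "c \<noteq> 0" using * j by (auto intro: Nat.gr0I)
    ultimately have "c = 1 \<or> c = 2" by auto
    then show "j = 2 * m \<or> j = 4 * m" using j by auto
  qed (use q m in auto)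
  have "(of_int (\<Sum>u\<in>UNIV. qchar (u ^ 4 + 1 :: 'a)) :: 'a) = (\<Sum>u\<in>UNIV. (u ^ 4 + 1) ^ (4 * m))"
    unfolding of_int_sum of_int_qchar[OF o] h ..
  also have "\<dots> = (\<Sum>u\<in>UNIV. \<Sum>j\<le>4 * m. of_nat ((4 * m) choose j) * u ^ (4 * j))"
    by (intro sum.cong refl) (subst binomial_ring, simp add: power_mult)
  also have "\<dots> = (\<Sum>j\<le>4 * m. of_nat ((4 * m) choose j) * (\<Sum>u\<in>UNIV. (u::'a) ^ (4 * j)))"
    by (subst sum.swap) (simp add: sum_distrib_left)
  also have "\<dots> = (\<Sum>j\<le>4 * m. if j = 2 * m \<or> j = 4 * m then - of_nat ((4 * m) choose j) else 0)"
    by (intro sum.cong refl) (use dv in \<open>auto simp: sum_power_finite_field\<close>)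
  also have "\<dots> = (\<Sum>j\<in>{2 * m, 4 * m}. - of_nat ((4 * m) choose j))"
    by (rule sum.mono_neutral_cong_right) auto
  also have "\<dots> = - of_nat ((4 * m) choose (2 * m)) - 1"
    using m by simp
  finally show ?thesis unfolding h .
qed

text \<open>Otherwise \<open>n\<close> is coprime to the cardinality, and a Bezout identity becomes
  \<open>0 = 1\<close> in the field.\<close>

lemma of_int_eq_0_imp_dvd:
  assumes "CARD('a::{field,finite}) = p ^ r" "prime p" "(of_int n :: 'a) = 0"
  shows "int p dvd n"
proof (rule ccontr)
  assume "\<not> int p dvd n"
  then have "coprime (int p ^ r) n"
    using assms(2) by (simp add: prime_imp_coprime)
  then obtain x y where "x * int p ^ r + y * n = 1"
    using bezout_int[of "int p ^ r" n] by auto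
  then have "(of_int (x * int (p ^ r) + y * n) :: 'a) = 1" by simp
  moreover have "(of_int (int (p ^ r)) :: 'a) = 0"
    using of_nat_CARD_eq_0[where 'a = 'a] assms(1) by simp
  ultimately show False using assms(3) unfolding of_int_add of_int_mult by (simp add: zero_power)
qed

text \<open>In odd characteristic and for nonzero \<open>D\<close>, this is minus the trace of
  Frobenius of the elliptic curve \<open>Y ^ 2 = X ^ 3 + D * X\<close>.\<close>

definition jacobsthal :: "'a::{field,finite} \<Rightarrow> int" where
  "jacobsthal D = (\<Sum>x\<in>UNIV. qchar (x * (x\<^sup>2 + D)))"

text \<open>Euler's criterion is applied twice: \<open>- 1\<close> is a square because
  \<open>4 * m\<close> is even, and its root \<open>i\<close> is one because
  \<open>i ^ (4 * m) = 1\<close>.\<close>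

lemma minus_one_eq_fourth_power:
  assumes "CARD('a::{field,finite}) mod 8 = 1"
  obtains z :: "'a::{field,finite}" where "z ^ 4 = - 1"
proof -
  define m where "m = CARD('a) div 8"
  have q: "CARD('a) = 8 * m + 1" using assms unfolding m_def by presburger
  have o: "odd CARD('a)" using q by simp
  have sq: "\<exists>y. x = y\<^sup>2" if "x ^ (4 * m) = 1" for x :: 'a
  proof -
    have "of_int (qchar x) = (1::'a)" using of_int_qchar[OF o, of x] that q by simp
    then have "qchar x \<noteq> 0" "qchar x \<noteq> -1"
      using one_neq_minus_one[OF o] by auto
    then show ?thesis by (auto simp: qchar_def split: if_splits)
  qed
  obtain i :: 'a where i: "- 1 = i\<^sup>2" using sq[of "- 1"] by (auto simp: power_mult)
  have "i ^ (4 * m) = ((i\<^sup>2)\<^sup>2) ^ m" by (simp add: power_mult[symmetric])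
  also have "\<dots> = 1" by (simp flip: i)
  finally obtain z where "i = z\<^sup>2" using sq by blast
  then have "z ^ 4 = - 1" using i by (simp add: power_mult[symmetric])
  then show ?thesis using that by blast
qed

text \<open>Substituting \<open>v\<close> for the square of \<open>u\<close> splits the sum. The
  part weighted by \<open>qchar v\<close> is the Jacobsthal sum; the unweighted part is
  \<open>- 1\<close>, as its quadratic argument has two distinct roots.\<close>

lemma sum_qchar_fourth:
  assumes "CARD('a::{field,finite}) mod 8 = 1"
  shows "(\<Sum>u\<in>UNIV. qchar (u ^ 4 + 1 :: 'a)) = jacobsthal (1::'a) - 1"
proof -
  have o: "odd CARD('a)" using assms by presburger
  obtain z :: 'a where "z ^ 4 = - 1" using minus_one_eq_fourth_power[OF assms] by blast
  then have i: "(z\<^sup>2)\<^sup>2 = - 1" by (simp add: power_mult[symmetric])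
  have ne: "z\<^sup>2 \<noteq> - z\<^sup>2" using i eq_minus_iff_zero[OF o, of "z\<^sup>2"] by auto
  have "(\<Sum>v\<in>UNIV. qchar (v\<^sup>2 + 1 :: 'a)) = (\<Sum>v\<in>UNIV. qchar ((v + z\<^sup>2) * (v + - (z\<^sup>2))))"
    by (intro sum.cong) (use i in \<open>auto simp: algebra_simps power2_eq_square\<close>)
  also have "\<dots> = - 1" using sum_qchar_quadratic[OF o, of "z\<^sup>2" "- (z\<^sup>2)"] ne by simp
  finally have 1: "(\<Sum>v\<in>UNIV. qchar (v\<^sup>2 + 1 :: 'a)) = - 1" .
  have "(\<Sum>u\<in>UNIV. qchar (u ^ 4 + 1 :: 'a)) = (\<Sum>u\<in>UNIV. qchar ((u\<^sup>2)\<^sup>2 + 1 :: 'a))"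
    by (simp add: power_mult[symmetric])
  also have "\<dots> = (\<Sum>v\<in>UNIV. (1 + qchar v) * qchar (v\<^sup>2 + 1 :: 'a))"
    by (rule sum_squares[OF o])
  also have "\<dots> = (\<Sum>v\<in>UNIV. qchar (v\<^sup>2 + 1 :: 'a)) + jacobsthal (1::'a)"
    by (simp add: jacobsthal_def qchar_mult[OF o] distrib_right sum.distrib)
  finally show ?thesis using 1 by simp
qed

text \<open>The two evaluations of the sum of \<open>qchar (u ^ 4 + 1)\<close> identify the
  Jacobsthal sum, in the field, with minus the quarter binomial coefficient, which is prime to
  \<open>p\<close>.\<close>

lemma jacobsthal_not_dvd:
  assumes "CARD('a::{field,finite}) = p ^ r" "prime p" "[p = 1] (mod 4)" "CARD('a) mod 8 = 1"
  shows "\<not> int p dvd jacobsthal (1::'a)"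
proof
  assume dv: "int p dvd jacobsthal (1::'a)"
  have r: "r > 0" 
  proof (rule Nat.gr0I)
    assume "r = 0"
    moreover have "card {0, 1::'a} \<le> CARD('a)" by (rule card_mono) auto
    ultimately show False using assms by simp
  qed
  have "(of_nat p :: 'a) ^ r = 0" using of_nat_CARD_eq_0[where 'a = 'a] assms(1) by simp
  then have p0: "(of_nat p :: 'a) = 0" by simp
  obtain c where "jacobsthal (1::'a) = int p * c" using dv by blast
  then have "(of_int (jacobsthal (1::'a)) :: 'a) = 0" by (simp add: p0)
  then have "(of_int (int (((CARD('a) - 1) div 2) choose ((CARD('a) - 1) div 4))) :: 'a) = 0"
    using of_int_sum_qchar_fourth[OF assms(4)] unfolding sum_qchar_fourth[OF assms(4)] by simp
  then have "int p dvd int (((CARD('a) - 1) div 2) choose ((CARD('a) - 1) div 4))"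
    by (rule of_int_eq_0_imp_dvd[OF assms(1,2)])
  then show False using not_dvd_quarter_binomial[OF assms(2,3), of r] assms(1) by simp
qed

section \<open>The second moment of the Jacobsthal sums\<close>

text \<open>Replacing \<open>x\<close> by \<open>m * x\<close> extracts the factor
  \<open>m ^ 3\<close>, which has the same character as \<open>m\<close>.\<close>

lemma jacobsthal_scale:
  fixes D m :: "'a::{field,finite}"
  assumes "odd CARD('a)" "m \<noteq> 0"
  shows "jacobsthal (D * m\<^sup>2) = qchar m * jacobsthal D"
proof -
  have "jacobsthal (D * m\<^sup>2) = (\<Sum>x\<in>UNIV. qchar ((m * x) * ((m * x)\<^sup>2 + D * m\<^sup>2)))"
    unfolding jacobsthal_def
    by (rule sum.reindex_bij_witness[of _ "\<lambda>y. m * y" "\<lambda>y. y / m"]) (use assms in auto)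
  also have "\<dots> = (\<Sum>x\<in>UNIV. qchar (m * m\<^sup>2 * (x * (x\<^sup>2 + D))))"
    by (intro sum.cong refl arg_cong[where f = qchar]) (simp add: algebra_simps power2_eq_square)
  also have "\<dots> = qchar m * jacobsthal D"
    by (simp add: qchar_mult[OF assms(1)] qchar_square[OF assms(2)] jacobsthal_def sum_distrib_left)
  finally show ?thesis .
qed

text \<open>The sum of \<open>(jacobsthal D)\<^sup>2\<close> over all \<open>D\<close> is computed
  twice: by quadratic classes of \<open>D\<close>, and by expanding the square and summing over
  \<open>D\<close> first.\<close>

lemma jacobsthal_squares:
  fixes g :: "'a::{field,finite}"
  assumes "CARD('a) mod 8 = 1" "qchar g = - 1"
  shows "(jacobsthal (1::'a))\<^sup>2 + (jacobsthal g)\<^sup>2 = 4 * int CARD('a)"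
proof -
  have o: "odd CARD('a)" using assms(1) by presburger
  obtain z :: 'a where "z ^ 4 = - 1" using minus_one_eq_fourth_power[OF assms(1)] by blast
  then have i: "(z\<^sup>2)\<^sup>2 = - 1" by (simp add: power_mult[symmetric])
  then have "z\<^sup>2 \<noteq> 0" by auto
  then have m1: "qchar (- 1 :: 'a) = 1" using qchar_square[of "z\<^sup>2"] i by simp
  then have qm: "qchar (- x) = qchar x" for x :: 'a using qchar_mult[OF o, of "- 1" x] by simp
  have g0: "g \<noteq> 0" using assms(2) by auto
  let ?q = "int CARD('a)"
  have gm: "(jacobsthal (D * m\<^sup>2))\<^sup>2 = (jacobsthal D)\<^sup>2" if "m \<noteq> 0" for D m :: 'a
    using qchar_square_if[of m] that by (simp add: jacobsthal_scale[OF o that] power_mult_distrib)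
  have J: "(jacobsthal D)\<^sup>2 = (if qchar D = 1 then (jacobsthal (1::'a))\<^sup>2 else (jacobsthal g)\<^sup>2)"
    if "D \<noteq> 0" for D :: 'a
  proof (cases "qchar D = 1")
    case True
    then obtain m where "D = m\<^sup>2" by (auto simp: qchar_def split: if_splits)
    moreover from this have "m \<noteq> 0" using that by auto
    ultimately show ?thesis using gm[of m 1] True by simp
  next
    case False
    moreover have "qchar D \<noteq> 0" using that by (simp add: qchar_def)
    ultimately have "qchar D = - 1" using qchar_cases[of D] by blast
    then have "qchar (D * g) = 1" by (simp add: qchar_mult[OF o] assms(2))
    then obtain m where m: "D * g = m\<^sup>2" by (auto simp: qchar_def split: if_splits)
    then have "m \<noteq> 0" using g0 that by auto
    moreover have "D = g * (m / g)\<^sup>2" using g0 m by (simp add: power2_eq_square field_simps)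
    ultimately show ?thesis using gm[of "m / g" g] False g0 by simp
  qed
  have J0: "jacobsthal (0::'a) = 0"
  proof -
    have "jacobsthal (0::'a) = (\<Sum>x\<in>UNIV. qchar (x::'a))"
      unfolding jacobsthal_def
    proof (intro sum.cong refl)
      show "qchar (x * (x\<^sup>2 + 0)) = qchar x" for x :: 'a
        by (cases "x = 0") (simp_all add: qchar_mult[OF o] qchar_square)
    qed
    then show ?thesis using o by simp
  qed
  have "2 * (\<Sum>D\<in>UNIV. (jacobsthal (D::'a))\<^sup>2) =
      2 * (\<Sum>D\<in>UNIV - {0}. (jacobsthal (D::'a))\<^sup>2)"
    by (subst sum.remove[of _ 0]) (simp_all add: J0)
  \<comment> \<open>The doubling allows one formula for both classes; its \<open>qchar D\<close>
    part then sums to zero.\<close>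
  also have "\<dots> = (\<Sum>D\<in>UNIV - {0::'a}. ((jacobsthal (1::'a))\<^sup>2 + (jacobsthal g)\<^sup>2) +
      qchar D * ((jacobsthal (1::'a))\<^sup>2 - (jacobsthal g)\<^sup>2))"
    unfolding sum_distrib_left
  proof (rule sum.cong[OF refl])
    fix D :: 'a assume "D \<in> UNIV - {0}"
    then have D: "D \<noteq> 0" by simp
    then have "qchar D \<noteq> 0" by (simp add: qchar_def)
    then consider "qchar D = 1" | "qchar D = - 1" using qchar_cases[of D] by blast
    then show "2 * (jacobsthal D)\<^sup>2 = ((jacobsthal (1::'a))\<^sup>2 + (jacobsthal g)\<^sup>2) +
        qchar D * ((jacobsthal (1::'a))\<^sup>2 - (jacobsthal g)\<^sup>2)"
      using J[OF D] by cases simp_all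
  qed
  also have "\<dots> = (?q - 1) * ((jacobsthal (1::'a))\<^sup>2 + (jacobsthal g)\<^sup>2)"
  proof -
    have "(\<Sum>D\<in>UNIV - {0}. qchar (D::'a)) = 0"
      using sum_qchar[OF o] by (subst (asm) sum.remove[of _ 0]) simp_all
    then show ?thesis
      using zero_less_card_finite[where 'a = 'a]
      by (simp add: sum.distrib sum_distrib_right[symmetric] card_Diff_singleton of_nat_diff)
  qed
  finally have L: "2 * (\<Sum>D\<in>UNIV. (jacobsthal (D::'a))\<^sup>2) =
      (?q - 1) * ((jacobsthal (1::'a))\<^sup>2 + (jacobsthal g)\<^sup>2)" .
  have "(\<Sum>D\<in>UNIV. (jacobsthal (D::'a))\<^sup>2) =
      (\<Sum>D\<in>UNIV. \<Sum>x\<in>UNIV. \<Sum>y\<in>UNIV. qchar (x * y :: 'a) * qchar ((D + x\<^sup>2) * (D + y\<^sup>2)))"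
    unfolding jacobsthal_def power2_eq_square[of "sum _ _"] sum_product
    by (intro sum.cong refl) (simp add: qchar_mult[OF o] ac_simps)
  also have "\<dots> = (\<Sum>x\<in>UNIV. \<Sum>D\<in>UNIV. \<Sum>y\<in>UNIV. qchar (x * y :: 'a) * qchar ((D + x\<^sup>2) * (D + y\<^sup>2)))"
    by (rule sum.swap)
  also have "\<dots> = (\<Sum>x\<in>UNIV. \<Sum>y\<in>UNIV. \<Sum>D\<in>UNIV. qchar (x * y :: 'a) * qchar ((D + x\<^sup>2) * (D + y\<^sup>2)))"
    by (rule sum.cong[OF refl], rule sum.swap)
  \<comment> \<open>Orthogonality gives \<open>?q - 1\<close> or \<open>- 1\<close>, that is,
    \<open>?q\<close> on the diagonal of squares minus a constant 1. The constant part factors into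
    two vanishing character sums.\<close>
  also have "\<dots> = (\<Sum>x\<in>UNIV. \<Sum>y\<in>UNIV. (if x\<^sup>2 = y\<^sup>2 then ?q * qchar (x * y :: 'a) else 0) - qchar x * qchar y)"
    unfolding sum_distrib_left[symmetric] sum_qchar_quadratic[OF o]
    by (intro sum.cong refl) (simp add: qchar_mult[OF o] algebra_simps)
  also have "\<dots> = (\<Sum>x\<in>UNIV. \<Sum>y\<in>UNIV. if x\<^sup>2 = y\<^sup>2 then ?q * qchar (x * y :: 'a) else 0)"
    using sum_qchar[OF o] by (simp add: sum_subtractf sum_distrib_left[symmetric])
  also have "\<dots> = (\<Sum>x\<in>UNIV - {0::'a}. 2 * ?q)"
  proof -
    have "(\<Sum>y\<in>UNIV. if x\<^sup>2 = y\<^sup>2 then ?q * qchar (x * y) else 0) = (if x = 0 then 0 else 2 * ?q)" for x :: 'a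
    proof -
      have "(\<Sum>y\<in>UNIV. if x\<^sup>2 = y\<^sup>2 then ?q * qchar (x * y) else 0) = (\<Sum>y\<in>{x, - x}. ?q * qchar (x * y))"
        by (rule sum.mono_neutral_cong_right) (auto simp: power2_eq_iff)
      also have "\<dots> = (if x = 0 then 0 else 2 * ?q)"
      proof (cases "x = 0")
        case False
        then have "x \<noteq> - x" using eq_minus_iff_zero[OF o, of x] by blast
        then show ?thesis using False by (simp add: qm power2_eq_square[symmetric] qchar_square)
      qed simp
      finally show ?thesis .
    qed
    then show ?thesis by (subst sum.remove[of _ 0]) simp_all
  qed
  also have "\<dots> = (?q - 1) * (2 * ?q)"
    using zero_less_card_finite[where 'a = 'a] by (simp add: card_Diff_singleton of_nat_diff)
  finally have "(?q - 1) * ((jacobsthal (1::'a))\<^sup>2 + (jacobsthal g)\<^sup>2) = (?q - 1) * (4 * ?q)"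
    by (simp only: L[symmetric])
  moreover have "?q \<noteq> 1"
  proof -
    have "card {0, 1::'a} \<le> CARD('a)" by (rule card_mono) auto
    then show ?thesis by simp
  qed
  ultimately show ?thesis by simp
qed

subsection \<open>The Fermat quartic and triangles\<close>

text \<open>The connection set of \<open>gen_paley 4\<close>; leaving out zero makes it a
  multiplicative group.\<close>

definition fourth_powers :: "'a::field set" where
  "fourth_powers = {x ^ 4 | x. x \<noteq> 0}"

lemma fourth_powers_mult: "x \<in> fourth_powers \<Longrightarrow> y \<in> fourth_powers \<Longrightarrow> x * y \<in> fourth_powers"
  unfolding fourth_powers_def by clarsimp (metis no_zero_divisors power_mult_distrib)

lemma fourth_powers_divide: "x \<in> fourth_powers \<Longrightarrow> y \<in> fourth_powers \<Longrightarrow> x / y \<in> fourth_powers"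
  unfolding fourth_powers_def by clarsimp (metis divide_eq_0_iff power_divide)

lemma zero_notin_fourth_powers: "0 \<notin> fourth_powers"
  by (simp add: fourth_powers_def)

lemma one_in_fourth_powers: "1 \<in> fourth_powers"
  unfolding fourth_powers_def by clarsimp (metis power_one zero_neq_one)

lemma minus_one_in_fourth_powers:
  assumes "CARD('a::{field,finite}) mod 8 = 1"
  shows "(- 1 :: 'a) \<in> fourth_powers"
proof -
  obtain z :: 'a where z: "z ^ 4 = - 1" using minus_one_eq_fourth_power[OF assms] by blast
  moreover from z have "z \<noteq> 0" by auto
  ultimately show ?thesis unfolding fourth_powers_def by force
qed

text \<open>The roots are \<open>c\<close> times the fourth roots of unity 1, \<open>- 1\<close>,
  \<open>j\<close>, \<open>- j\<close>, where \<open>j\<close> is a square root of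
  \<open>- 1\<close>; odd characteristic keeps them distinct.\<close>

lemma card_fourth_roots:
  fixes c :: "'a::{field,finite}"
  assumes "CARD('a) mod 8 = 1" "c \<noteq> 0"
  shows "card {x. x ^ 4 = c ^ 4} = 4"
proof -
  have o: "odd CARD('a)" using assms(1) by presburger
  obtain z :: 'a where "z ^ 4 = - 1" using minus_one_eq_fourth_power[OF assms(1)] by blast
  then have i: "(z\<^sup>2)\<^sup>2 = - 1" by (simp add: power_mult[symmetric])
  define j where "j = z\<^sup>2"
  have j: "j\<^sup>2 = - 1" using i by (simp add: j_def)
  have m1: "(1::'a) \<noteq> - 1" using one_neq_minus_one[OF o] .
  have "x ^ 4 = c ^ 4 \<longleftrightarrow> x = c \<or> x = - c \<or> x = j * c \<or> x = - (j * c)" for x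
  proof -
    have sq: "t ^ 4 = (t\<^sup>2)\<^sup>2" for t :: 'a by (simp add: power_mult[symmetric])
    have "x ^ 4 = c ^ 4 \<longleftrightarrow> (x\<^sup>2)\<^sup>2 = (c\<^sup>2)\<^sup>2" unfolding sq ..
    also have "\<dots> \<longleftrightarrow> x\<^sup>2 = c\<^sup>2 \<or> x\<^sup>2 = (j * c)\<^sup>2"
      unfolding power2_eq_iff[of "x\<^sup>2" "c\<^sup>2"] by (simp add: power_mult_distrib j)
    finally show ?thesis by (simp add: power2_eq_iff)
  qed
  then have eq: "{x. x ^ 4 = c ^ 4} = {c, - c, j * c, - (j * c)}" by blast
  have sq: "c\<^sup>2 \<noteq> (j * c)\<^sup>2"
    using eq_minus_iff_zero[OF o, of "c\<^sup>2"] assms(2) by (simp add: power_mult_distrib j)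
  then have ne: "c \<noteq> j * c" "c \<noteq> - (j * c)" "- c \<noteq> j * c" "- c \<noteq> - (j * c)"
    by (metis power2_minus)+
  have "j * c \<noteq> 0" using j assms(2) by auto
  then have "c \<noteq> - c" "j * c \<noteq> - (j * c)"
    using eq_minus_iff_zero[OF o] assms(2) by blast+
  then show ?thesis unfolding eq using ne by simp
qed

lemma sum_fourth_powers:
  fixes f :: "'a::{field,finite} \<Rightarrow> int"
  assumes "CARD('a) mod 8 = 1"
  shows "(\<Sum>x\<in>UNIV - {0}. f (x ^ 4)) = 4 * (\<Sum>y\<in>fourth_powers. f y)"
proof -
  have "(\<Sum>x\<in>UNIV - {0}. f (x ^ 4)) =
      (\<Sum>y\<in>fourth_powers. \<Sum>x\<in>{x \<in> UNIV - {0}. x ^ 4 = y}. f (x ^ 4))"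
    by (rule sum.group[symmetric]) (auto simp: fourth_powers_def)
  also have "\<dots> = (\<Sum>y\<in>fourth_powers. 4 * f y)"
  proof (intro sum.cong refl)
    fix y :: 'a assume "y \<in> fourth_powers"
    then obtain c where c: "y = c ^ 4" "c \<noteq> 0" by (auto simp: fourth_powers_def)
    have "{x \<in> UNIV - {0}. x ^ 4 = y} = {x. x ^ 4 = c ^ 4}" using c by auto
    then show "(\<Sum>x\<in>{x \<in> UNIV - {0}. x ^ 4 = y}. f (x ^ 4)) = 4 * f y"
      using card_fourth_roots[OF assms c(2)] c by simp
  qed
  finally show ?thesis by (simp add: sum_distrib_left)
qed

lemma card_fourth_powers:
  assumes "CARD('a::{field,finite}) mod 8 = 1"
  shows "4 * int (card (fourth_powers :: 'a set)) = int CARD('a) - 1"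
  using sum_fourth_powers[OF assms, of "\<lambda>_. 1"] zero_less_card_finite[where 'a = 'a]
  by (simp add: card_Diff_singleton of_nat_diff)

text \<open>Grouping by fourth powers writes the Jacobsthal sum as 2 plus 4 times a sum of signs.
  The number of signs is one less than the even number of fourth powers, so their sum is odd. For
  \<open>e = - J(1) / 2\<close> this means \<open>e = 1\<close> modulo 4.\<close>

lemma jacobsthal_mod_8:
  assumes "CARD('a::{field,finite}) mod 8 = 1"
  shows "jacobsthal (1::'a) mod 8 = 6"
proof -
  let ?F = "fourth_powers :: 'a set"
  have "jacobsthal (1::'a) - 1 = (\<Sum>u\<in>UNIV. qchar (u ^ 4 + 1 :: 'a))"
    by (rule sum_qchar_fourth[OF assms, symmetric])
  also have "\<dots> = 1 + (\<Sum>u\<in>UNIV - {0}. qchar (u ^ 4 + 1 :: 'a))"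
    using qchar_square[of "1::'a"] by (subst sum.remove[of _ 0]) simp_all
  also have "(\<Sum>u\<in>UNIV - {0}. qchar (u ^ 4 + 1 :: 'a)) = 4 * (\<Sum>y\<in>?F. qchar (y + 1))"
    by (rule sum_fourth_powers[OF assms])
  also have "(\<Sum>y\<in>?F. qchar (y + 1)) = (\<Sum>y\<in>?F - {- 1}. qchar (y + 1))"
    by (subst sum.remove[of _ "- 1"]) (use minus_one_in_fourth_powers[OF assms] in simp_all)
  finally have J: "jacobsthal (1::'a) = 2 + 4 * (\<Sum>y\<in>?F - {- 1}. qchar (y + 1))" by simp
  have "even (\<Sum>y\<in>?F - {- 1}. qchar (y + 1) - 1)"
  proof (rule dvd_sum)
    fix y :: 'a assume "y \<in> ?F - {- 1}"
    then have "y + 1 \<noteq> 0" by (auto simp: add_eq_0_iff2)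
    then show "even (qchar (y + 1) - 1)" by (simp add: qchar_def)
  qed
  then have "even ((\<Sum>y\<in>?F - {- 1}. qchar (y + 1)) - int (card (?F - {- 1})))"
    by (simp add: sum_subtractf)
  moreover have "odd (int (card (?F - {- 1})))"
  proof -
    have "card ?F > 0" using one_in_fourth_powers by (auto simp: card_gt_0_iff)
    then have "int (card (?F - {- 1})) = int (card ?F) - 1"
      using minus_one_in_fourth_powers[OF assms] by (simp add: card_Diff_singleton of_nat_diff)
    moreover have "even (int (card ?F))"
    proof -
      define n where "n = card ?F"
      have "4 * int n = int CARD('a) - 1" using card_fourth_powers[OF assms] by (simp add: n_def)
      then show ?thesis using assms unfolding n_def[symmetric] by presburger
    qed
    ultimately show ?thesis by simp
  qed
  ultimately have "odd (\<Sum>y\<in>?F - {- 1}. qchar (y + 1))" by simp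
  then show ?thesis unfolding J by (auto elim!: oddE simp: algebra_simps)
qed

section \<open>Points on the Fermat quartic\<close>

text \<open>Expanding the product leaves four sums over the conic, equal to \<open>?q - 1\<close>,
  \<open>?J\<close>, \<open>?J\<close> and \<open>?J - 2\<close>.\<close>

lemma sum_conic_qchar:
  assumes "CARD('a::{field,finite}) mod 8 = 1"
  shows "(\<Sum>v\<in>UNIV. \<Sum>w\<in>UNIV. if v\<^sup>2 + w\<^sup>2 = (1::'a) then (1 + qchar v) * (1 + qchar w) else 0) =
    int CARD('a) - 3 + 3 * jacobsthal (1::'a)"
proof -
  let ?q = "int CARD('a)" and ?J = "jacobsthal (1::'a)"
  have o: "odd CARD('a)" using assms by presburger
  obtain z :: 'a where z4: "z ^ 4 = - 1" using minus_one_eq_fourth_power[OF assms] by blast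
  define i where "i = z\<^sup>2"
  have i: "i\<^sup>2 = - 1" using z4 by (simp add: i_def power_mult[symmetric])
  have z0: "z \<noteq> 0" "i \<noteq> 0" using z4 by (auto simp: i_def)
  have two: "(2::'a) \<noteq> 0" using one_neq_minus_one[OF o] by (metis add_eq_0_iff one_add_one)
  have four: "(4::'a) \<noteq> 0" using two no_zero_divisors[of "2::'a" 2] by simp
  have m1: "qchar (- 1 :: 'a) = 1" using qchar_square[of i] z0 i by simp
  have qm: "qchar (- x) = qchar x" for x :: 'a using qchar_mult[OF o, of "- 1" x] m1 by simp
  define C where "C f = (\<Sum>v\<in>UNIV. \<Sum>w\<in>UNIV. if v\<^sup>2 + w\<^sup>2 = (1::'a) then f v w else (0::int))"
    for f :: "'a \<Rightarrow> 'a \<Rightarrow> int"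
  have fib: "C (\<lambda>v w. f v) = (\<Sum>v\<in>UNIV. f v * (1 + qchar (1 - v\<^sup>2)))" for f :: "'a \<Rightarrow> int"
  proof -
    have "(\<Sum>w\<in>UNIV. if v\<^sup>2 + w\<^sup>2 = 1 then f v else 0) = f v * (1 + qchar (1 - v\<^sup>2))" for v
    proof -
      have "(\<Sum>w\<in>UNIV. if v\<^sup>2 + w\<^sup>2 = 1 then f v else 0) = (\<Sum>w\<in>{w. w\<^sup>2 = 1 - v\<^sup>2}. f v)"
        by (rule sum.mono_neutral_cong_right) (auto simp: algebra_simps)
      then show ?thesis using card_square_roots[OF o, of "1 - v\<^sup>2"] by simp
    qed
    then show ?thesis by (simp add: C_def)
  qed
  have C0: "C (\<lambda>v w. 1) = ?q - 1"
  proof -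
    have "(\<Sum>v\<in>UNIV. qchar (1 - v\<^sup>2 :: 'a)) = (\<Sum>v\<in>UNIV. qchar ((v + 1) * (v + - 1) :: 'a))"
    proof (intro sum.cong refl)
      fix v :: 'a
      have "(v + 1) * (v + - 1) = - (1 - v\<^sup>2)" by (simp add: algebra_simps power2_eq_square)
      then show "qchar (1 - v\<^sup>2) = qchar ((v + 1) * (v + - 1))" by (simp only: qm)
    qed
    also have "\<dots> = - 1"
      using one_neq_minus_one[OF o] sum_qchar_quadratic[OF o, of 1 "- 1"] by simp
    finally show ?thesis using fib[of "\<lambda>_. 1"] by (simp add: sum.distrib)
  qed
  have C1: "C (\<lambda>v w. qchar v) = ?J"
  proof -
    have "C (\<lambda>v w. qchar v) = (\<Sum>v\<in>UNIV. qchar v * qchar (1 - v\<^sup>2 :: 'a))"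
      using fib[of qchar] o by (simp add: distrib_left sum.distrib)
    also have "\<dots> = jacobsthal (- 1 :: 'a)"
      unfolding jacobsthal_def
    proof (intro sum.cong refl)
      fix v :: 'a
      have "v * (v\<^sup>2 + - 1) = - (v * (1 - v\<^sup>2))" by (simp add: algebra_simps)
      then show "qchar v * qchar (1 - v\<^sup>2) = qchar (v * (v\<^sup>2 + - 1))"
        by (simp only: qm qchar_mult[OF o])
    qed
    \<comment> \<open>Here \<open>- 1\<close> is the square of \<open>i\<close>, and
      \<open>i\<close> is itself a square, so the twist does not change the sum.\<close>
    also have "\<dots> = qchar i * ?J"
      using jacobsthal_scale[OF o z0(2), of 1] i by simp
    also have "qchar i = 1" unfolding i_def by (rule qchar_square) fact
    finally show ?thesis by simp
  qed
  have C1': "C (\<lambda>v w. qchar w) = ?J"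
  proof -
    have "C (\<lambda>v w. qchar w) = C (\<lambda>v w. qchar v)"
      unfolding C_def by (subst sum.swap) (simp add: add.commute)
    then show ?thesis using C1 by simp
  qed
  have C2: "C (\<lambda>v w. qchar v * qchar w) = ?J - 2"
  proof -
    have "C (\<lambda>v w. qchar v * qchar w) =
        (\<Sum>p\<in>UNIV. if (fst p)\<^sup>2 + (snd p)\<^sup>2 = (1::'a) then qchar (fst p) * qchar (snd p) else 0)"
      unfolding C_def by (simp add: sum.cartesian_product case_prod_beta)
    also have "\<dots> = (\<Sum>p\<in>{p. (fst p)\<^sup>2 + (snd p)\<^sup>2 = (1::'a)}. qchar (fst p) * qchar (snd p))"
      by (rule sum.mono_neutral_cong_right) auto
    \<comment> \<open>Parametrise the conic by \<open>s = v + i w\<close>; then \<open>s\<^sup>4 - 1 = (2 z s)\<^sup>2 v w\<close>.\<close>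
    also have "\<dots> = (\<Sum>s\<in>UNIV - {0}. qchar (s ^ 4 - 1 :: 'a))"
    proof (rule sum.reindex_bij_witness[of _ "\<lambda>s. ((s + 1 / s) / 2, (s - 1 / s) / (2 * i))"
            "\<lambda>p. fst p + i * snd p"])
      fix p :: "'a \<times> 'a" assume "p \<in> {p. (fst p)\<^sup>2 + (snd p)\<^sup>2 = 1}"
      then obtain v w where p: "p = (v, w)" and vw: "v\<^sup>2 + w\<^sup>2 = 1" by (cases p) auto
      have "(v + i * w) * (v - i * w) = v\<^sup>2 - i\<^sup>2 * w\<^sup>2"
        by (simp add: algebra_simps power2_eq_square)
      then have prod: "(v + i * w) * (v - i * w) = 1" using vw i by simp
      then have s0: "v + i * w \<noteq> 0" by auto
      have inv: "1 / (v + i * w) = v - i * w" using prod s0 by (simp add: field_simps)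
      show "fst p + i * snd p \<in> UNIV - {0}" using s0 p by simp
      have "((v + i * w) + (v - i * w)) / 2 = v" using two by (simp add: field_simps)
      moreover have "((v + i * w) - (v - i * w)) / (2 * i) = w" using two z0 by (simp add: field_simps)
      ultimately show "((fst p + i * snd p + 1 / (fst p + i * snd p)) / 2,
          (fst p + i * snd p - 1 / (fst p + i * snd p)) / (2 * i)) = p"
        by (simp add: p inv)
      have "(v + i * w) ^ 4 - 1 = (v + i * w) ^ 4 - ((v + i * w) * (v - i * w))\<^sup>2"
        using prod by simp
      also have "\<dots> = (2 * z * (v + i * w))\<^sup>2 * (v * w)"
        unfolding power_mult_distrib by (simp add: i_def[symmetric]) (algebra)
      finally show "qchar ((fst p + i * snd p) ^ 4 - 1) = qchar (fst p) * qchar (snd p)"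
        using s0 two z0 qchar_square[of "2 * z * (v + i * w)"] by (simp add: p qchar_mult[OF o])
    next
      fix s :: 'a assume "s \<in> UNIV - {0}"
      then have s: "s \<noteq> 0" by simp
      show "fst ((s + 1 / s) / 2, (s - 1 / s) / (2 * i)) + i * snd ((s + 1 / s) / 2, (s - 1 / s) / (2 * i)) = s"
        using s two four z0 by (simp add: field_simps)
      have "(A / 2)\<^sup>2 + (B / (2 * i))\<^sup>2 = (A\<^sup>2 - B\<^sup>2) / 2\<^sup>2" for A B :: 'a
        by (simp add: power_divide power_mult_distrib i diff_divide_distrib)
      then have "((s + 1 / s) / 2)\<^sup>2 + ((s - 1 / s) / (2 * i))\<^sup>2 = ((s + 1 / s)\<^sup>2 - (s - 1 / s)\<^sup>2) / 2\<^sup>2" .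
      also have "(s + 1 / s)\<^sup>2 - (s - 1 / s)\<^sup>2 = 2\<^sup>2"
        using s by (simp add: power2_eq_square algebra_simps)
      finally have "((s + 1 / s) / 2)\<^sup>2 + ((s - 1 / s) / (2 * i))\<^sup>2 = 1" using four by simp
      then show "((s + 1 / s) / 2, (s - 1 / s) / (2 * i)) \<in> {p. (fst p)\<^sup>2 + (snd p)\<^sup>2 = 1}" by simp
    qed
    also have "\<dots> = (\<Sum>s\<in>UNIV. qchar (s ^ 4 - 1 :: 'a)) - 1"
      by (subst sum.remove[of UNIV 0]) (simp_all add: m1)
    \<comment> \<open>With \<open>s = z * u\<close> and \<open>z ^ 4 = - 1\<close>, the argument
      becomes \<open>- (u ^ 4 + 1)\<close>, and the sign is invisible to
      \<open>qchar\<close>.\<close>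
    also have "(\<Sum>s\<in>UNIV. qchar (s ^ 4 - 1 :: 'a)) = (\<Sum>u\<in>UNIV. qchar (u ^ 4 + 1 :: 'a))"
    proof (rule sum.reindex_bij_witness[of _ "\<lambda>u. z * u" "\<lambda>s. s / z"])
      fix s :: 'a
      have "(s / z) ^ 4 + 1 = - (s ^ 4 - 1)" by (simp add: power_divide z4)
      then show "qchar ((s / z) ^ 4 + 1) = qchar (s ^ 4 - 1)" by (simp only: qm)
    qed (use z0 in auto)
    also have "\<dots> = ?J - 1" by (rule sum_qchar_fourth[OF assms])
    finally show ?thesis by simp
  qed
  have add: "C (\<lambda>v w. f v w + g v w) = C f + C g" for f g
    unfolding C_def sum.distrib[symmetric] by (intro sum.cong refl) simp
  have "C (\<lambda>v w. (1 + qchar v) * (1 + qchar w)) = C (\<lambda>v w. (1 + qchar v) + (qchar w + qchar v * qchar w))"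
    by (simp add: algebra_simps)
  also have "\<dots> = ?q - 3 + 3 * ?J"
    unfolding add C0 C1 C1' C2 by simp
  finally show ?thesis unfolding C_def .
qed

lemma sum_fermat_quartic:
  assumes "CARD('a::{field,finite}) mod 8 = 1"
  shows "(\<Sum>x\<in>UNIV. \<Sum>y\<in>UNIV. if x ^ 4 + y ^ 4 = (1::'a) then 1 else (0::int)) =
    int CARD('a) - 3 + 3 * jacobsthal (1::'a)"
proof -
  have o: "odd CARD('a)" using assms by presburger
  have "(\<Sum>x\<in>UNIV. \<Sum>y\<in>UNIV. if x ^ 4 + y ^ 4 = (1::'a) then 1 else (0::int)) =
      (\<Sum>x\<in>UNIV. \<Sum>y\<in>UNIV. if (x\<^sup>2)\<^sup>2 + (y\<^sup>2)\<^sup>2 = (1::'a) then 1 else (0::int))"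
    by (simp add: power_mult[symmetric])
  also have "\<dots> = (\<Sum>v\<in>UNIV. (1 + qchar v) * (\<Sum>y\<in>UNIV. if v\<^sup>2 + (y\<^sup>2)\<^sup>2 = (1::'a) then 1 else 0))"
    by (rule sum_squares[OF o])
  also have "\<dots> = (\<Sum>v\<in>UNIV. (1 + qchar v) *
      (\<Sum>w\<in>UNIV. (1 + qchar w) * (if v\<^sup>2 + w\<^sup>2 = (1::'a) then 1 else 0)))"
    unfolding sum_squares[OF o, of "\<lambda>w. if _ + w\<^sup>2 = 1 then 1 else 0"] ..
  also have "\<dots> = (\<Sum>v\<in>UNIV. \<Sum>w\<in>UNIV. if v\<^sup>2 + w\<^sup>2 = (1::'a) then (1 + qchar v) * (1 + qchar w) else 0)"
    unfolding sum_distrib_left by (intro sum.cong refl) simp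
  also have "\<dots> = int CARD('a) - 3 + 3 * jacobsthal (1::'a)"
    by (rule sum_conic_qchar[OF assms])
  finally show ?thesis .
qed

text \<open>Affine points of the quartic with nonzero coordinates come in blocks of 16, one for each
  pair of fourth powers. The axes carry 4 points each, which turns the \<open>- 3\<close> of the
  point count into \<open>- 11\<close>.\<close>

lemma cyclotomic_number_quartic:
  assumes "CARD('a::{field,finite}) mod 8 = 1"
  shows "16 * int (card {c \<in> fourth_powers. c - 1 \<in> (fourth_powers :: 'a set)}) =
    int CARD('a) - 11 + 3 * jacobsthal (1::'a)"
proof -
  let ?F = "fourth_powers :: 'a set"
  let ?A = "{c \<in> ?F. c - 1 \<in> ?F}"
  obtain z :: 'a where z4: "z ^ 4 = - 1" using minus_one_eq_fourth_power[OF assms] by blast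
  then have z0: "z \<noteq> 0" by auto
  have one: "(\<Sum>y\<in>UNIV - {0}. if y ^ 4 = (1::'a) then 1 else (0::int)) = 4"
    unfolding sum_fourth_powers[OF assms, of "\<lambda>y. if y = 1 then 1 else 0"]
    using one_in_fourth_powers by (simp add: sum.delta')
  \<comment> \<open>Scaling \<open>y\<close> by \<open>z\<close> changes the sign of
    \<open>y ^ 4\<close>, which produces the difference \<open>x ^ 4 - 1\<close>.\<close>
  have "(\<Sum>x\<in>UNIV - {0}. \<Sum>y\<in>UNIV - {0}. if x ^ 4 + y ^ 4 = (1::'a) then 1 else (0::int)) =
      (\<Sum>x\<in>UNIV - {0}. \<Sum>y\<in>UNIV - {0}. if y ^ 4 = x ^ 4 - (1::'a) then 1 else (0::int))"
  proof (rule sum.cong[OF refl])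
    fix x :: 'a
    show "(\<Sum>y\<in>UNIV - {0}. if x ^ 4 + y ^ 4 = (1::'a) then 1 else (0::int)) =
        (\<Sum>y\<in>UNIV - {0}. if y ^ 4 = x ^ 4 - (1::'a) then 1 else 0)"
      by (rule sum.reindex_bij_witness[of _ "\<lambda>y. y / z" "\<lambda>y. z * y"])
        (use z0 z4 in \<open>auto simp: power_mult_distrib algebra_simps\<close>)
  qed
  also have "\<dots> = (\<Sum>x\<in>UNIV - {0}. 4 * (\<Sum>d\<in>?F. if d = x ^ 4 - (1::'a) then 1 else (0::int)))"
    by (rule sum.cong[OF refl], rule sum_fourth_powers[OF assms])
  also have "\<dots> = 4 * (\<Sum>c\<in>?F. 4 * (\<Sum>d\<in>?F. if d = c - (1::'a) then 1 else (0::int)))"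
    by (rule sum_fourth_powers[OF assms])
  also have "\<dots> = 16 * (\<Sum>c\<in>?F. if c - 1 \<in> ?F then 1 else (0::int))"
    by (simp add: sum_distrib_left[symmetric] sum.delta)
  also have "(\<Sum>c\<in>?F. if c - 1 \<in> ?F then 1 else (0::int)) = (\<Sum>c\<in>?A. 1)"
    by (rule sum.mono_neutral_cong_right) auto
  finally have A: "(\<Sum>x\<in>UNIV - {0}. \<Sum>y\<in>UNIV - {0}. if x ^ 4 + y ^ 4 = (1::'a) then 1 else (0::int)) =
      16 * int (card ?A)" by simp
  have inner: "(\<Sum>y\<in>UNIV. if x ^ 4 + y ^ 4 = (1::'a) then 1 else (0::int)) =
      (if x ^ 4 = 1 then 1 else 0) + (\<Sum>y\<in>UNIV - {0}. if x ^ 4 + y ^ 4 = (1::'a) then 1 else 0)" for x :: 'a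
    by (subst sum.remove[of _ 0]) simp_all
  have "(\<Sum>x\<in>UNIV. \<Sum>y\<in>UNIV. if x ^ 4 + y ^ 4 = (1::'a) then 1 else (0::int)) =
      (\<Sum>y\<in>UNIV. if y ^ 4 = (1::'a) then 1 else 0) +
      (\<Sum>x\<in>UNIV - {0}. \<Sum>y\<in>UNIV. if x ^ 4 + y ^ 4 = (1::'a) then 1 else (0::int))"
    by (subst sum.remove[of _ 0]) simp_all
  also have "(\<Sum>y\<in>UNIV. if y ^ 4 = (1::'a) then 1 else 0) = (4::int)"
    using one by (subst sum.remove[of _ 0]) simp_all
  also have "(\<Sum>x\<in>UNIV - {0}. \<Sum>y\<in>UNIV. if x ^ 4 + y ^ 4 = (1::'a) then 1 else (0::int)) = 
      4 + 16 * int (card ?A)"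
    unfolding inner sum.distrib one A ..
  finally show ?thesis using sum_fermat_quartic[OF assms] by simp
qed

section \<open>From the cyclotomic number to triangles\<close>

lemma card_ordered_triangles:
  fixes E :: "'a::finite \<Rightarrow> 'a \<Rightarrow> bool"
  assumes sym: "\<And>u v. E u v \<Longrightarrow> E v u" and irrefl: "\<And>u. \<not> E u u"
  shows "card {(u, v, w). E u v \<and> E u w \<and> E v w} =
    6 * card {T. card T = 3 \<and> (\<forall>u\<in>T. \<forall>v\<in>T. u \<noteq> v \<longrightarrow> E u v)}"
proof -
  let ?O = "{(u, v, w). E u v \<and> E u w \<and> E v w}"
  let ?F = "{T. card T = 3 \<and> (\<forall>u\<in>T. \<forall>v\<in>T. u \<noteq> v \<longrightarrow> E u v)}"
  let ?g = "\<lambda>(u, v, w). {u, v, w}"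
  have sub: "?g ` ?O \<subseteq> ?F"
  proof
    fix T assume "T \<in> ?g ` ?O"
    then obtain u v w where T: "T = {u, v, w}" and *: "E u v" "E u w" "E v w" by auto
    then have "u \<noteq> v" "u \<noteq> w" "v \<noteq> w" using irrefl by auto
    moreover have "E v u" "E w u" "E w v" using * by (blast intro: sym)+
    ultimately show "T \<in> ?F" using * T by auto
  qed
  have "card ?O = (\<Sum>T\<in>?F. \<Sum>t\<in>{t \<in> ?O. ?g t = T}. 1)"
    using sub by (subst sum.group) auto
  also have "\<dots> = (\<Sum>T\<in>?F. 6)"
  proof (intro sum.cong refl)
    fix T assume T: "T \<in> ?F"
    then obtain a b c where abc: "T = {a, b, c}" "a \<noteq> b" "b \<noteq> c" "a \<noteq> c"
      by (auto simp: card_3_iff)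
    have E: "E a b" "E b a" "E a c" "E c a" "E b c" "E c b" using T abc by auto
    have "{t \<in> ?O. ?g t = T} = {(a, b, c), (a, c, b), (b, a, c), (b, c, a), (c, a, b), (c, b, a)}"
    proof (intro subset_antisym subsetI)
      fix t assume "t \<in> {t \<in> ?O. ?g t = T}"
      then obtain u v w where t: "t = (u, v, w)" and uvw: "{u, v, w} = {a, b, c}"
        and e: "E u v" "E u w" "E v w" using abc by auto
      have "u \<noteq> v" "u \<noteq> w" "v \<noteq> w" using e irrefl by auto
      moreover have "u \<in> {a, b, c}" "v \<in> {a, b, c}" "w \<in> {a, b, c}" using uvw by auto
      ultimately show "t \<in> {(a, b, c), (a, c, b), (b, a, c), (b, c, a), (c, a, b), (c, b, a)}"
        unfolding t by auto
    qed (use E abc in auto)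
    then show "(\<Sum>t\<in>{t \<in> ?O. ?g t = T}. 1) = (6::nat)" using abc by simp
  qed
  finally show ?thesis by simp
qed

text \<open>Translating the first vertex to 0 and dividing by the first difference \<open>s\<close>
  normalises an ordered triangle to \<open>0, 1, c\<close> with \<open>c\<close> and
  \<open>c - 1\<close> fourth powers. The constant 384 is \<open>6 * 4 * 16\<close>: orderings,
  index of the fourth powers, and the scaling of the cyclotomic number.\<close>

lemma num_triangles_gen_paley_4:
  assumes "CARD('a::{field,finite}) mod 8 = 1"
  shows "384 * int (num_triangles (gen_paley 4 :: 'a pair_pre_digraph)) =
    int CARD('a) * (int CARD('a) - 1) * (int CARD('a) - 11 + 3 * jacobsthal (1::'a))"
proof -
  let ?F = "fourth_powers :: 'a set"
  let ?A = "{c \<in> ?F. c - 1 \<in> ?F}"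
  let ?E = "\<lambda>u v :: 'a. v - u \<in> ?F"
  have num: "num_triangles (gen_paley 4 :: 'a pair_pre_digraph) =
      card {T. card T = 3 \<and> (\<forall>u\<in>T. \<forall>v\<in>T. u \<noteq> v \<longrightarrow> ?E u v)}"
    unfolding num_triangles_def gen_paley_def cayley_graph_def fourth_powers_def by simp
  have sym: "?E v u" if "?E u v" for u v
    using fourth_powers_mult[OF minus_one_in_fourth_powers[OF assms] that] by simp
  have "bij_betw (\<lambda>(u, s, c). (u, u + s, u + s * c)) ((UNIV :: 'a set) \<times> ?F \<times> ?A)
      {(u, v, w). ?E u v \<and> ?E u w \<and> ?E v w}"
  proof (rule bij_betw_byWitness[where f' = "\<lambda>(u, v, w). (u, v - u, (w - u) / (v - u))"])
    show "\<forall>t\<in>UNIV \<times> ?F \<times> ?A. (\<lambda>(u, v, w). (u, v - u, (w - u) / (v - u)))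
        ((\<lambda>(u, s, c). (u, u + s, u + s * c)) t) = t"
      using zero_notin_fourth_powers[where 'a = 'a] by auto
    show "\<forall>t\<in>{(u, v, w). ?E u v \<and> ?E u w \<and> ?E v w}. (\<lambda>(u, s, c). (u, u + s, u + s * c))
        ((\<lambda>(u, v, w). (u, v - u, (w - u) / (v - u))) t) = t"
      using zero_notin_fourth_powers[where 'a = 'a] by auto
    show "(\<lambda>(u, s, c). (u, u + s, u + s * c)) ` ((UNIV :: 'a set) \<times> ?F \<times> ?A) \<subseteq>
        {(u, v, w). ?E u v \<and> ?E u w \<and> ?E v w}"
    proof clarsimp
      fix s c :: 'a assume *: "s \<in> ?F" "c \<in> ?F" "c - 1 \<in> ?F"
      show "s * c \<in> ?F \<and> s * c - s \<in> ?F"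
        using fourth_powers_mult[OF *(1,2)] fourth_powers_mult[OF *(1,3)] by (simp add: algebra_simps)
    qed
    show "(\<lambda>(u, v, w). (u, v - u, (w - u) / (v - u))) `
        {(u, v, w). ?E u v \<and> ?E u w \<and> ?E v w} \<subseteq> UNIV \<times> ?F \<times> ?A"
    proof clarsimp
      fix u v w :: 'a assume *: "v - u \<in> ?F" "w - u \<in> ?F" "w - v \<in> ?F"
      have "v - u \<noteq> 0" using * zero_notin_fourth_powers by metis
      then have "(w - u) / (v - u) - 1 = (w - v) / (v - u)" by (simp add: field_simps)
      then show "(w - u) / (v - u) \<in> ?F \<and> (w - u) / (v - u) - 1 \<in> ?F"
        using fourth_powers_divide[OF *(2,1)] fourth_powers_divide[OF *(3,1)] by simp
    qed
  qed
  then have "card ((UNIV :: 'a set) \<times> ?F \<times> ?A) = card {(u, v, w). ?E u v \<and> ?E u w \<and> ?E v w}"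
    by (rule bij_betw_same_card)
  also have "\<dots> = 6 * num_triangles (gen_paley 4 :: 'a pair_pre_digraph)"
    unfolding num using sym zero_notin_fourth_powers by (intro card_ordered_triangles) auto
  finally have "CARD('a) * (card ?F * card ?A) = 6 * num_triangles (gen_paley 4 :: 'a pair_pre_digraph)"
    by (simp add: card_cartesian_product)
  from arg_cong[OF this, of int]
  have "384 * int (num_triangles (gen_paley 4 :: 'a pair_pre_digraph)) =
      int CARD('a) * (4 * int (card ?F)) * (16 * int (card ?A))" by simp
  then show ?thesis
    unfolding card_fourth_powers[OF assms] cyclotomic_number_quartic[OF assms] by simp
qed

subsection \<open>Representations by \<open>X\<^sup>2 + 4 Y\<^sup>2\<close>\<close>

text \<open>Weighting the second representation by \<open>e\<^sup>2\<close> and the first by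
  \<open>a\<^sup>2\<close> cancels the mixed term and leaves a difference of two squares.\<close>

lemma two_square_product:
  fixes q a b e f :: int
  assumes "q = e\<^sup>2 + 4 * f\<^sup>2" "q = a\<^sup>2 + 4 * b\<^sup>2"
  shows "q * (e\<^sup>2 - a\<^sup>2) = 4 * (e * b - a * f) * (e * b + a * f)"
  using assms by algebra

text \<open>The product of the two factors \<open>e b - a f\<close> and \<open>e b + a f\<close> is divisible by \<open>q\<close>, and \<open>p\<close> divides
  only one of them; the two-square identity then forces that factor to vanish.\<close>

lemma two_square_rep_unique:
  fixes p r :: nat and a b e f :: int
  assumes p: "prime p" "odd p" and r: "r \<ge> 1"
    and 1: "int p ^ r = e\<^sup>2 + 4 * f\<^sup>2" and 2: "int p ^ r = a\<^sup>2 + 4 * b\<^sup>2"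
    and ce: "coprime e (int p)" and ca: "coprime a (int p)"
  shows "e\<^sup>2 = a\<^sup>2"
proof -
  let ?q = "int p ^ r"
  have pp: "prime (int p)" using p by simp
  have q0: "?q > 0" using prime_gt_0_nat[OF p(1)] by simp
  \<comment> \<open>Stated for a variable \<open>f'\<close> so that it serves both factors, with
    \<open>f' = f\<close> and \<open>f' = - f\<close>.\<close>
  have main: "e\<^sup>2 = a\<^sup>2" if dv: "?q dvd e * b - a * f'" and 1: "?q = e\<^sup>2 + 4 * f'\<^sup>2" for f'
  proof -
    define d where "d = e * b - a * f'"
    \<comment> \<open>Brahmagupta's identity. A nonzero multiple \<open>d\<close> of
      \<open>?q\<close> would make \<open>4 * d\<^sup>2\<close> exceed the right-hand side.\<close>
    have id: "(e * a + 4 * f' * b)\<^sup>2 + 4 * d\<^sup>2 = ?q * ?q"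
      by (subst (1) 1, subst 2) (simp add: d_def power2_eq_square algebra_simps)
    have "d = 0"
    proof (rule ccontr)
      assume "d \<noteq> 0"
      moreover have "?q dvd d" using dv by (simp add: d_def)
      ultimately have "\<bar>?q\<bar> \<le> \<bar>d\<bar>" using dvd_imp_le_int by blast
      then have "?q\<^sup>2 \<le> d\<^sup>2" by (simp only: abs_le_square_iff)
      moreover have "?q\<^sup>2 > 0" using q0 by simp
      ultimately show False using id zero_le_power2[of "e * a + 4 * f' * b"]
        by (simp add: power2_eq_square[of ?q])
    qed
    moreover have "?q * (e\<^sup>2 - a\<^sup>2) = 4 * d * (e * b + a * f')"
      unfolding d_def by (rule two_square_product[OF 1 2])
    ultimately show ?thesis using q0 by auto
  qed
  have prod: "?q * (e\<^sup>2 - a\<^sup>2) = 4 * (e * b - a * f) * (e * b + a * f)"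
    by (rule two_square_product[OF assms(4) 2])
  have c4: "coprime ?q 4"
  proof -
    have "coprime (int p) (2 ^ 2)" using p(2) by (simp only: coprime_power_right_iff) simp
    then show ?thesis by simp
  qed
  have "?q dvd 4 * ((e * b - a * f) * (e * b + a * f))"
    using prod by (metis dvd_triv_left mult.assoc)
  then have dvq: "?q dvd (e * b - a * f) * (e * b + a * f)"
    using c4 coprime_dvd_mult_right_iff by blast
  have pq: "int p dvd ?q" using r by (simp add: dvd_power)
  have nb: "\<not> int p dvd b"
  proof
    assume "int p dvd b"
    then have "int p dvd 4 * b\<^sup>2" by (simp add: power2_eq_square)
    then have "int p dvd a\<^sup>2" using pq 2 by (metis dvd_add_left_iff)
    then have "int p dvd a" using pp prime_dvd_power by blast
    then show False using ca pp by (meson coprime_common_divisor dvd_refl not_prime_unit)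
  qed
  have "\<not> (int p dvd e * b - a * f \<and> int p dvd e * b + a * f)"
  proof
    assume "int p dvd e * b - a * f \<and> int p dvd e * b + a * f"
    then have "int p dvd (e * b - a * f) + (e * b + a * f)" using dvd_add by blast
    then have "int p dvd 2 * (e * b)" by (simp add: mult.commute)
    moreover have "coprime (int p) 2" using p(2) by simp
    ultimately have "int p dvd e * b" using coprime_dvd_mult_right_iff by blast
    then show False using nb ce pp
      by (meson coprime_common_divisor dvd_refl not_prime_unit prime_dvd_mult_iff)
  qed
  then consider "coprime ?q (e * b - a * f)" | "coprime ?q (e * b + a * f)"
    using pp prime_imp_coprime by (metis coprime_power_left_iff)
  then show ?thesis
  proof cases
    case 1
    have "?q dvd e * b - a * (- f)" using dvq coprime_dvd_mult_right_iff[OF 1] by simp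
    then show ?thesis using main[of "- f"] assms(4) by simp
  next
    case 2
    have "?q dvd e * b - a * f" using dvq coprime_dvd_mult_left_iff[OF 2] by blast
    then show ?thesis using main[of f] assms(4) by simp
  qed
qed

lemma cong_1_mod_4_square_eq:
  fixes a e :: int
  assumes "[a = 1] (mod 4)" "[e = 1] (mod 4)" "e\<^sup>2 = a\<^sup>2"
  shows "e = a"
proof -
  have "a mod 4 = 1" "e mod 4 = 1" using assms by (auto simp: cong_def)
  moreover have "e = a \<or> e = - a" using assms(3) by (simp add: power2_eq_iff)
  ultimately show ?thesis by presburger
qed

text \<open>Pairs \<open>(x, y)\<close> stand for the Gaussian integers \<open>x + 2 y i\<close>.\<close>

fun gauss_pow :: "int \<Rightarrow> int \<Rightarrow> nat \<Rightarrow> int \<times> int" where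
  "gauss_pow e f 0 = (1, 0)"
| "gauss_pow e f (Suc n) = (let (x, y) = gauss_pow e f n in (e * x - 4 * f * y, e * y + f * x))"

lemma gauss_pow_complex:
  "(of_int e + 2 * of_int f * \<i>) ^ n =
    (of_int (fst (gauss_pow e f n)) + 2 * of_int (snd (gauss_pow e f n)) * \<i> :: complex)"
  by (induction n) (auto simp: case_prod_beta complex_eq_iff algebra_simps)

lemma gauss_pow_norm:
  "(fst (gauss_pow e f n))\<^sup>2 + 4 * (snd (gauss_pow e f n))\<^sup>2 = (e\<^sup>2 + 4 * f\<^sup>2) ^ n"
proof (induction n)
  case (Suc n)
  have "(fst (gauss_pow e f (Suc n)))\<^sup>2 + 4 * (snd (gauss_pow e f (Suc n)))\<^sup>2 =
      (e\<^sup>2 + 4 * f\<^sup>2) * ((fst (gauss_pow e f n))\<^sup>2 + 4 * (snd (gauss_pow e f n))\<^sup>2)"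
    by (simp add: case_prod_beta power2_eq_square algebra_simps)
  then show ?case using Suc by simp
qed simp

lemma gauss_pow_cong:
  assumes "[e = 1] (mod 4)"
  shows "[fst (gauss_pow e f n) = 1] (mod 4)"
proof (induction n)
  case (Suc n)
  have "[e * fst (gauss_pow e f n) - 4 * (f * snd (gauss_pow e f n)) = 1 * 1 - 0] (mod 4)"
    by (intro cong_diff cong_mult assms Suc) (simp add: cong_def)
  then show ?case by (simp add: case_prod_beta mult.assoc)
qed simp

text \<open>Modulo a prime above \<open>p\<close> that divides the conjugate of \<open>z = e + 2 f i\<close>, the real part of \<open>z ^ n\<close>
  is \<open>i\<close> times its imaginary part; comparing with \<open>n = 1\<close> yields the divisibility carried through
  the induction.\<close>

lemma gauss_pow_coprime:
  fixes p :: int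
  assumes p: "prime p" "odd p" and dv: "p dvd e\<^sup>2 + 4 * f\<^sup>2" and ce: "coprime e p" and n: "n \<ge> 1"
  shows "coprime (fst (gauss_pow e f n)) p"
proof -
  have "p dvd e * fst (gauss_pow e f n) + 4 * f * snd (gauss_pow e f n) \<and> coprime (fst (gauss_pow e f n)) p"
    using n
  proof (induction n rule: dec_induct)
    case base
    then show ?case using dv ce by (simp add: power2_eq_square mult.assoc)
  next
    case (step n)
    obtain x y where xy: "gauss_pow e f n = (x, y)" by (cases "gauss_pow e f n")
    have IH: "p dvd e * x + 4 * f * y" "coprime x p" using step xy by auto
    \<comment> \<open>The carried expression for the next power is \<open>x\<close> times the norm,
      hence divisible by \<open>p\<close>.\<close>
    have "e * (e * x - 4 * f * y) + 4 * f * (e * y + f * x) = x * (e\<^sup>2 + 4 * f\<^sup>2)"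
      by (simp add: power2_eq_square algebra_simps)
    then have A: "p dvd e * (e * x - 4 * f * y) + 4 * f * (e * y + f * x)" using dv by simp
    \<comment> \<open>Modulo \<open>p\<close> the next real part agrees with
      \<open>2 * e * x\<close>, since the other summand is the divisible quantity of the induction
      hypothesis.\<close>
    have "coprime (2 * e * x) p" using p ce IH(2) by simp
    moreover have "2 * e * x = (e * x - 4 * f * y) + (e * x + 4 * f * y)" by simp
    ultimately have cop: "coprime ((e * x - 4 * f * y) + (e * x + 4 * f * y)) p" by simp
    have "coprime (e * x - 4 * f * y) p"
    proof (rule coprimeI)
      fix d assume d: "d dvd e * x - 4 * f * y" "d dvd p"
      have "d dvd (e * x - 4 * f * y) + (e * x + 4 * f * y)"
        by (rule dvd_add[OF d(1) dvd_trans[OF d(2) IH(1)]])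
      then show "is_unit d" by (rule coprime_common_divisor[OF cop _ d(2)])
    qed
    then show ?case using A xy by simp
  qed
  then show ?thesis by blast
qed

subsection \<open>Triangles of quartic Paley graphs\<close>

text \<open>The witnesses are \<open>e = - J(1) / 2\<close> and \<open>f = J(g) / 4\<close> for a
  nonsquare \<open>g\<close>.\<close>

lemma num_triangles_quartic:
  fixes p r :: nat
  assumes p: "prime p" "[p = 1] (mod 4)" and q: "CARD('a::{field,finite}) = p ^ r" "CARD('a) mod 8 = 1"
  obtains e f :: int where "int CARD('a) = e\<^sup>2 + 4 * f\<^sup>2" "[e = 1] (mod 4)" "coprime e (int p)"
    "384 * int (num_triangles (gen_paley 4 :: 'a pair_pre_digraph)) =
      int CARD('a) * (int CARD('a) - 1) * (int CARD('a) - 6 * e - 11)"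
proof -
  let ?J = "jacobsthal (1::'a)" and ?q = "int CARD('a)"
  have o: "odd CARD('a)" using q(2) by presburger
  obtain g :: 'a where g: "qchar g = - 1" using exists_nonsquare[OF o] by blast
  define e where "e = - (?J div 2)"
  have J: "?J = - 2 * e" "[e = 1] (mod 4)"
    using jacobsthal_mod_8[OF q(2)] unfolding e_def cong_def by presburger+
  have sq: "?J\<^sup>2 + (jacobsthal g)\<^sup>2 = 4 * ?q" by (rule jacobsthal_squares[OF q(2) g])
  have "(jacobsthal g)\<^sup>2 = 4 * (?q - e\<^sup>2)" using sq unfolding J(1) by (simp add: power_mult_distrib)
  then have "even (jacobsthal g)" by (metis dvd_triv_left even_numeral even_mult_iff even_power)
  then obtain h where h: "jacobsthal g = 2 * h" by blast
  have eh: "?q = e\<^sup>2 + h\<^sup>2" using sq unfolding J(1) h by (simp add: power_mult_distrib)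
  \<comment> \<open>Parity supplies the second factor 2: \<open>?q\<close> and \<open>e\<close> are
    odd, so \<open>h\<close>, half of \<open>jacobsthal g\<close>, is even.\<close>
  have "odd e" using J(2) unfolding cong_def by presburger
  then have "even (h\<^sup>2)" using eh o by (metis even_add even_of_nat even_power odd_add)
  then have "even h" by simp
  then obtain f where f: "h = 2 * f" by blast
  have 1: "?q = e\<^sup>2 + 4 * f\<^sup>2" using eh unfolding f by (simp add: power_mult_distrib)
  have "\<not> int p dvd ?J" by (rule jacobsthal_not_dvd[OF q(1) p q(2)])
  then have "\<not> int p dvd e" unfolding J(1) by (metis dvd_mult)
  then have "coprime e (int p)"
    using p(1) by (metis coprime_commute prime_imp_coprime prime_int_nat_transfer prime_nat_int_transfer)
  moreover have "384 * int (num_triangles (gen_paley 4 :: 'a pair_pre_digraph)) =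
      ?q * (?q - 1) * (?q - 6 * e - 11)"
    using num_triangles_gen_paley_4[OF q(2)] unfolding J(1) by (simp add: algebra_simps)
  ultimately show ?thesis using that 1 J(2) by blast
qed

text \<open>Uniqueness of the normalised \<open>e\<close> carries the formula from the
  representation by Jacobsthal sums to any admissible one.\<close>

lemma num_triangles_quartic_rep:
  fixes p r :: nat and e f :: int
  assumes p: "prime p" "[p = 1] (mod 4)" and r: "r \<ge> 1"
    and q: "CARD('a::{field,finite}) = p ^ r" "CARD('a) mod 8 = 1"
    and e: "int (p ^ r) = e\<^sup>2 + 4 * f\<^sup>2" "[e = 1] (mod 4)" "coprime e (int p)"
  shows "real (num_triangles (gen_paley 4 :: 'a pair_pre_digraph)) =
    real (p ^ r) * (real (p ^ r) - 1) * (real (p ^ r) - 6 * of_int e - 11) / 384"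
proof -
  obtain a b :: int where a: "int CARD('a) = a\<^sup>2 + 4 * b\<^sup>2" "[a = 1] (mod 4)" "coprime a (int p)"
    and N: "384 * int (num_triangles (gen_paley 4 :: 'a pair_pre_digraph)) =
      int CARD('a) * (int CARD('a) - 1) * (int CARD('a) - 6 * a - 11)"
    using num_triangles_quartic[OF p q] by blast
  have "odd p" using p(2) unfolding cong_def by presburger
  then have "e\<^sup>2 = a\<^sup>2"
    using two_square_rep_unique[OF p(1) _ r, of e f a b] e a q(1) by simp
  then have ea: "e = a" using cong_1_mod_4_square_eq a(2) e(2) by blast
  have "real_of_int (384 * int (num_triangles (gen_paley 4 :: 'a pair_pre_digraph))) =
      real_of_int (int (p ^ r) * (int (p ^ r) - 1) * (int (p ^ r) - 6 * e - 11))"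
    unfolding N ea q(1) ..
  then show ?thesis by simp
qed

theorem theorem3p6:
  fixes p r q l :: nat
  assumes "prime p" and "[p = 1] (mod 4)"
    and "r \<ge> 1" and "q = p ^ r" and "[q = 1] (mod 8)"
    and "l \<ge> 1"
    and "CARD('a::{field,finite}) = q"
    and "CARD('b::{field,finite}) = q ^ l"
  shows
    "real (num_triangles (gen_paley 4 :: 'b pair_pre_digraph)) =
       triangles_from_base q l (num_triangles (gen_paley 4 :: 'a pair_pre_digraph))
     \<and> (\<exists>e1 f1 :: int. int q = e1\<^sup>2 + 4 * f1\<^sup>2 \<and> [e1 = 1] (mod 4) \<and> coprime e1 (int p))
     \<and> (\<forall>e1 f1 :: int. int q = e1\<^sup>2 + 4 * f1\<^sup>2 \<and> [e1 = 1] (mod 4) \<and> coprime e1 (int p) \<longrightarrow>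
          (let z = of_int e1 + 2 * of_int f1 * \<i> :: complex;
               z' = of_int e1 - 2 * of_int f1 * \<i> :: complex;
               el = Re (z ^ l)
           in 1 / 2 * z ^ l + 1 / 2 * z' ^ l = complex_of_real el
            \<and> real (num_triangles (gen_paley 4 :: 'b pair_pre_digraph)) =
                real q ^ l * (real q ^ l - 1) * (real q ^ l - 6 * el - 11) / (2 ^ 7 * 3)))"
proof -
  let ?Na = "num_triangles (gen_paley 4 :: 'a pair_pre_digraph)"
  let ?Nb = "num_triangles (gen_paley 4 :: 'b pair_pre_digraph)"
  have qa: "CARD('a) = p ^ r" "CARD('a) mod 8 = 1"
    using assms(4,5,7) by (auto simp: cong_def)
  have ql: "q ^ l = p ^ (r * l)" using assms(4) by (simp add: power_mult)
  have "[q ^ l = 1 ^ l] (mod 8)" by (rule cong_pow) fact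
  then have qb: "CARD('b) = p ^ (r * l)" "CARD('b) mod 8 = 1"
    using assms(8) ql by (auto simp: cong_def)
  have rl: "r * l \<ge> 1" using assms(3,6) by simp
  have "odd p" using assms(2) unfolding cong_def by presburger
  have main: "real ?Nb = real q ^ l * (real q ^ l - 1) *
      (real q ^ l - 6 * Re ((of_int e + 2 * of_int f * \<i>) ^ l) - 11) / (2 ^ 7 * 3)"
    if e: "int q = e\<^sup>2 + 4 * f\<^sup>2" "[e = 1] (mod 4)" "coprime e (int p)" for e f :: int
  proof -
    \<comment> \<open>The \<open>l\<close>-th power of \<open>e + 2 f i\<close> is an admissible
      representation of \<open>q ^ l\<close>, so the formula applies directly over
      \<open>'b\<close>.\<close>
    let ?e = "fst (gauss_pow e f l)" and ?f = "snd (gauss_pow e f l)"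
    have "int (p ^ (r * l)) = ?e\<^sup>2 + 4 * ?f\<^sup>2"
      unfolding gauss_pow_norm e(1)[symmetric] ql[symmetric] by simp
    moreover have "[?e = 1] (mod 4)" by (rule gauss_pow_cong) fact
    moreover have "int p dvd e\<^sup>2 + 4 * f\<^sup>2"
      using assms(3,4) unfolding e(1)[symmetric] by (simp add: dvd_power)
    then have "coprime ?e (int p)"
      using assms(1,6) \<open>odd p\<close> e(3) by (intro gauss_pow_coprime) auto
    ultimately have "real ?Nb = real (p ^ (r * l)) * (real (p ^ (r * l)) - 1) *
        (real (p ^ (r * l)) - 6 * of_int ?e - 11) / 384"
      by (intro num_triangles_quartic_rep[OF assms(1,2) rl qb])
    moreover have "Re ((of_int e + 2 * of_int f * \<i>) ^ l) = of_int ?e"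
      unfolding gauss_pow_complex by simp
    ultimately show ?thesis unfolding ql[symmetric] by simp
  qed
  obtain e f :: int where e: "int q = e\<^sup>2 + 4 * f\<^sup>2" "[e = 1] (mod 4)" "coprime e (int p)"
    using num_triangles_quartic[OF assms(1,2) qa] assms(7) by metis
  have Na: "real ?Na = real q * (real q - 1) * (real q - 6 * of_int e - 11) / 384"
    using num_triangles_quartic_rep[OF assms(1-3) qa, of e f] e assms(4) by simp
  have "q > 1"
    using one_less_power[OF prime_gt_1_nat[OF assms(1)], of r] assms(3,4) by simp
  then have q1: "real q * (real q - 1) \<noteq> 0" by simp
  \<comment> \<open>Inverting the formula over \<open>'a\<close> recovers exactly \<open>e\<close>
    from the triangle count.\<close>
  have eq: "(real q - 11 - 2 ^ 7 * 3 * real ?Na / (real q * (real q - 1))) / 6 = of_int e"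
    unfolding Na using q1 by (simp add: field_simps)
  have qr: "real q = (of_int e)\<^sup>2 + 4 * (of_int f)\<^sup>2"
    using arg_cong[OF e(1), of real_of_int] by simp
  have "sqrt (real q - (of_int e)\<^sup>2) = sqrt ((2 * of_int f)\<^sup>2)"
    by (simp add: qr power_mult_distrib)
  then have sq: "sqrt (real q - (of_int e)\<^sup>2) = \<bar>2 * of_int f\<bar>" unfolding real_sqrt_abs .
  \<comment> \<open>The square root forgets the sign of \<open>f\<close>; the result is the Gaussian
    integer or its conjugate, whose powers have equal real parts.\<close>
  have "Complex (of_int e) \<bar>2 * of_int f\<bar> = of_int e + 2 * of_int f * \<i> \<or>
      Complex (of_int e) \<bar>2 * of_int f\<bar> = cnj (of_int e + 2 * of_int f * \<i>)"
    by (auto simp: complex_eq_iff abs_if)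
  then have "Re (Complex (of_int e) \<bar>2 * of_int f\<bar> ^ l) = Re ((of_int e + 2 * of_int f * \<i>) ^ l)"
    by (metis complex_cnj_power cnj.simps(1))
  then have base: "real ?Nb = triangles_from_base q l ?Na"
    unfolding triangles_from_base_def Let_def eq sq using main[OF e] by simp
  have conj: "1 / 2 * (of_int e1 + 2 * of_int f1 * \<i>) ^ l + 1 / 2 * (of_int e1 - 2 * of_int f1 * \<i>) ^ l =
      complex_of_real (Re ((of_int e1 + 2 * of_int f1 * \<i>) ^ l))" for e1 f1 :: int
  proof -
    have "(of_int e1 - 2 * of_int f1 * \<i>) ^ l = cnj ((of_int e1 + 2 * of_int f1 * \<i>) ^ l)"
      by simp
    then show ?thesis by (simp add: complex_eq_iff del: complex_cnj_power)
  qed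
  show ?thesis
    unfolding Let_def
  proof (intro conjI allI impI)
    show "real ?Nb = triangles_from_base q l ?Na" by (rule base)
    show "\<exists>e1 f1 :: int. int q = e1\<^sup>2 + 4 * f1\<^sup>2 \<and> [e1 = 1] (mod 4) \<and> coprime e1 (int p)"
      using e by blast
  qed (rule conj, use main in blast)
qed

end
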